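(* Let $c\in\{1,-1\}$ and let $f\colon M^n\to\mathbb{Q}^n_c\times\mathbb{R}$, $n\ge 3$, be a hypersurface with constant principal curvatures whose respective multiplicities are also constant, having function $\nu$ with $\nu(p)\neq 0$ for all $p\in M^n$. If exactly one principal curvature has multiplicity equal to one, then the vector field $T$ is a principal direction corresponding to that curvature. Moreover, all the principal curvatures having multiplicity greater than one do not vanish.
   Context: $\mathbb{Q}^n_c$ denotes the unit sphere $\mathbb{S}^n$ if $c=1$ and the hyperbolic space $\mathbb{H}^n$ (curvature $-1$) if $c=-1$. A hypersurface $f\colon M^n\to\mathbb{Q}^n_c\times\mathbb{R}$ is an isometric immersion of a (connected) Riemannian $n$-manifold with unit normal field $\eta$ and shape operator $A$; principal curvatures are the eigenvalues of $A$. With $\partial/\partial t$ the unit vector field tangent to the factor $\mathbb{R}$, the tangent vector field $T$ on $M^n$ and the smooth function $\nu$ are defined by $\partial/\partial t=df(T)+\nu\eta$. "$T$ is a principal direction corresponding to $\lambda$" means that $T$ is nowhere zero and $AT=\lambda T$. The final assertion ("Moreover") is made under the same hypothesis that exactly one principal curvature has multiplicity one. *)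

theory Defs
  imports "HOL-Analysis.Analysis"
begin

section \<open>Smooth functions on open subsets of normed spaces\<close>

text \<open>
  Only meant for open sets \<open>S\<close> and finite-dimensional domains, where continuity of all iterated
  directional derivatives amounts to continuity of the iterated Frechet derivatives.
\<close>

primrec Ck_on ::
  "nat \<Rightarrow> ('a::real_normed_vector \<Rightarrow> 'b::real_normed_vector) \<Rightarrow> 'a set \<Rightarrow> bool" where
  "Ck_on 0 h S \<longleftrightarrow> continuous_on S h"
| "Ck_on (Suc k) h S \<longleftrightarrow>
     (\<forall>x\<in>S. h differentiable (at x)) \<and> (\<forall>v. Ck_on k (\<lambda>x. frechet_derivative h (at x) v) S)"

definition smooth_on ::
  "('a::real_normed_vector \<Rightarrow> 'b::real_normed_vector) \<Rightarrow> 'a set \<Rightarrow> bool" where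
  "smooth_on h S \<longleftrightarrow> (\<forall>k. Ck_on k h S)"


section \<open>Smooth manifolds of dimension \<open>CARD('n)\<close>\<close>

type_synonym ('m, 'n) chart = "'m set \<times> ('m \<Rightarrow> real ^ 'n)"

definition chart_inv :: "('m, 'n::finite) chart \<Rightarrow> real ^ 'n \<Rightarrow> 'm" where
  "chart_inv \<kappa> = inv_into (fst \<kappa>) (snd \<kappa>)"

definition smooth_atlas :: "'m topology \<Rightarrow> ('m, 'n::finite) chart set \<Rightarrow> bool" where
  "smooth_atlas X \<A> \<longleftrightarrow>
     (\<forall>(U, \<phi>)\<in>\<A>. openin X U \<and> open (\<phi> ` U) \<and>
        homeomorphic_map (subtopology X U) (top_of_set (\<phi> ` U)) \<phi>) \<and>
     (\<Union>(U, \<phi>)\<in>\<A>. U) = topspace X \<and>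
     (\<forall>(U, \<phi>)\<in>\<A>. \<forall>(V, \<psi>)\<in>\<A>. smooth_on (\<psi> \<circ> chart_inv (U, \<phi>)) (\<phi> ` (U \<inter> V)))"

definition smooth_manifold :: "'m topology \<Rightarrow> ('m, 'n::finite) chart set \<Rightarrow> bool" where
  "smooth_manifold X \<A> \<longleftrightarrow>
     Hausdorff_space X \<and> second_countable X \<and> smooth_atlas X \<A>"

definition smooth_map ::
  "('m, 'n::finite) chart set \<Rightarrow> ('m \<Rightarrow> 'e::real_normed_vector) \<Rightarrow> bool" where
  "smooth_map \<A> h \<longleftrightarrow> (\<forall>(U, \<phi>)\<in>\<A>. smooth_on (h \<circ> chart_inv (U, \<phi>)) (\<phi> ` U))"

text \<open>
  The tangent space at \<open>p\<close> is the model space \<open>real ^ 'n\<close>, identified with the usual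
  tangent space through one chart around \<open>p\<close> chosen once and for all. Hence a vector field is a
  function \<open>'m \<Rightarrow> real ^ 'n\<close>, whose value at \<open>p\<close> is to be read in the chart chosen at \<open>p\<close>.
\<close>

definition chart_at :: "('m, 'n::finite) chart set \<Rightarrow> 'm \<Rightarrow> ('m, 'n) chart" where
  "chart_at \<A> p = (SOME \<kappa>. \<kappa> \<in> \<A> \<and> p \<in> fst \<kappa>)"

definition differential_at ::
  "('m, 'n::finite) chart set \<Rightarrow> ('m \<Rightarrow> 'e::real_normed_vector) \<Rightarrow> 'm \<Rightarrow> real ^ 'n \<Rightarrow> 'e" where
  "differential_at \<A> h p =
     frechet_derivative (h \<circ> chart_inv (chart_at \<A> p)) (at (snd (chart_at \<A> p) p))"

text \<open>The tangent vector at \<open>p\<close> whose coordinates in the chart \<open>\<kappa>\<close> are \<open>u\<close>:\<close>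

definition tangent_of_coords ::
  "('m, 'n::finite) chart set \<Rightarrow> ('m, 'n) chart \<Rightarrow> 'm \<Rightarrow> real ^ 'n \<Rightarrow> real ^ 'n" where
  "tangent_of_coords \<A> \<kappa> p u =
     frechet_derivative (snd (chart_at \<A> p) \<circ> chart_inv \<kappa>) (at (snd \<kappa> p)) u"

definition riemannian_metric ::
  "'m topology \<Rightarrow> ('m, 'n::finite) chart set \<Rightarrow> ('m \<Rightarrow> real ^ 'n \<Rightarrow> real ^ 'n \<Rightarrow> real) \<Rightarrow> bool"
where
  "riemannian_metric X \<A> g \<longleftrightarrow>
     (\<forall>p\<in>topspace X. bilinear (g p) \<and> (\<forall>u v. g p u v = g p v u) \<and>
        (\<forall>u. u \<noteq> 0 \<longrightarrow> 0 < g p u u)) \<and>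
     (\<forall>\<kappa>\<in>\<A>. \<forall>u v. smooth_on
        (\<lambda>x. g (chart_inv \<kappa> x) (tangent_of_coords \<A> \<kappa> (chart_inv \<kappa> x) u)
                               (tangent_of_coords \<A> \<kappa> (chart_inv \<kappa> x) v))
        (snd \<kappa> ` fst \<kappa>))"


section \<open>The ambient spaces \<open>Q\<^sub>c \<times> \<real>\<close>\<close>

text \<open>
  For \<open>c = 1\<close> the factor \<open>Q\<^sub>c\<close> is the unit sphere in Euclidean space, for \<open>c = -1\<close> it is
  the upper sheet of the hyperboloid in Minkowski space. In both cases it has dimension
  \<open>CARD('n)\<close>, and the Riemannian metric of \<open>Q\<^sub>c \<times> \<real>\<close> is the restriction of \<open>ambient_form c\<close> to
  its tangent spaces.
\<close>

type_synonym 'n ambient = "((real ^ 'n) \<times> real) \<times> real"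

definition ambient_form :: "real \<Rightarrow> 'n::finite ambient \<Rightarrow> 'n ambient \<Rightarrow> real" where
  "ambient_form c = (\<lambda>((x, s), t) ((x', s'), t'). x \<bullet> x' + c * s * s' + t * t')"

definition space_form :: "real \<Rightarrow> ((real ^ 'n::finite) \<times> real) set" where
  "space_form c = {(x, s). x \<bullet> x + c * s\<^sup>2 = c \<and> (c = -1 \<longrightarrow> 0 < s)}"

definition product_space :: "real \<Rightarrow> 'n::finite ambient set" where
  "product_space c = space_form c \<times> UNIV"

definition position_normal :: "'n::finite ambient \<Rightarrow> 'n ambient" where
  "position_normal y = (fst y, 0)"

definition product_tangent_space :: "real \<Rightarrow> 'n::finite ambient \<Rightarrow> 'n ambient set" where
  "product_tangent_space c y = {w. ambient_form c w (position_normal y) = 0}"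

text \<open>
  The projection onto \<open>product_tangent_space c y\<close> along its normal line; note that
  \<open>ambient_form c N N = c = 1 / c\<close> for \<open>N = position_normal y\<close> and \<open>y \<in> product_space c\<close>.
\<close>

definition product_tangent_proj ::
  "real \<Rightarrow> 'n::finite ambient \<Rightarrow> 'n ambient \<Rightarrow> 'n ambient" where
  "product_tangent_proj c y w =
     w - (c * ambient_form c w (position_normal y)) *\<^sub>R position_normal y"

text \<open>The unit field \<open>\<partial>/\<partial>t\<close> tangent to the factor \<open>\<real>\<close>:\<close>

definition partial_t :: "'n::finite ambient" where
  "partial_t = (0, 1)"


section \<open>Hypersurfaces of \<open>Q\<^sub>c \<times> \<real>\<close>\<close>

definition isometric_immersion ::
  "real \<Rightarrow> 'm topology \<Rightarrow> ('m, 'n::finite) chart set \<Rightarrow> ('m \<Rightarrow> real ^ 'n \<Rightarrow> real ^ 'n \<Rightarrow> real)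
     \<Rightarrow> ('m \<Rightarrow> 'n ambient) \<Rightarrow> bool" where
  "isometric_immersion c X \<A> g f \<longleftrightarrow>
     smooth_map \<A> f \<and> f ` topspace X \<subseteq> product_space c \<and>
     (\<forall>p\<in>topspace X. inj (differential_at \<A> f p) \<and>
        (\<forall>u v. ambient_form c (differential_at \<A> f p u) (differential_at \<A> f p v) = g p u v))"

definition unit_normal_field ::
  "real \<Rightarrow> 'm topology \<Rightarrow> ('m, 'n::finite) chart set \<Rightarrow> ('m \<Rightarrow> 'n ambient)
     \<Rightarrow> ('m \<Rightarrow> 'n ambient) \<Rightarrow> bool" where
  "unit_normal_field c X \<A> f \<eta> \<longleftrightarrow>
     smooth_map \<A> \<eta> \<and>
     (\<forall>p\<in>topspace X. \<eta> p \<in> product_tangent_space c (f p) \<and>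
        ambient_form c (\<eta> p) (\<eta> p) = 1 \<and>
        (\<forall>u. ambient_form c (\<eta> p) (differential_at \<A> f p u) = 0))"

text \<open>
  The Levi-Civita connection of \<open>Q\<^sub>c \<times> \<real>\<close> is the tangential part of the flat one of the
  surrounding vector space; this is the induced covariant derivative of a field \<open>\<xi>\<close> along \<open>f\<close>.
\<close>

definition covariant_derivative ::
  "real \<Rightarrow> ('m, 'n::finite) chart set \<Rightarrow> ('m \<Rightarrow> 'n ambient) \<Rightarrow> ('m \<Rightarrow> 'n ambient)
     \<Rightarrow> 'm \<Rightarrow> real ^ 'n \<Rightarrow> 'n ambient" where
  "covariant_derivative c \<A> f \<xi> p u = product_tangent_proj c (f p) (differential_at \<A> \<xi> p u)"

text \<open>The Weingarten formula, which determines \<open>A\<close> on \<open>topspace X\<close> because \<open>f\<close> is an immersion:\<close>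

definition is_shape_operator ::
  "real \<Rightarrow> 'm topology \<Rightarrow> ('m, 'n::finite) chart set \<Rightarrow> ('m \<Rightarrow> 'n ambient)
     \<Rightarrow> ('m \<Rightarrow> 'n ambient) \<Rightarrow> ('m \<Rightarrow> real ^ 'n \<Rightarrow> real ^ 'n) \<Rightarrow> bool" where
  "is_shape_operator c X \<A> f \<eta> A \<longleftrightarrow>
     (\<forall>p\<in>topspace X. \<forall>u.
        differential_at \<A> f p (A p u) = - covariant_derivative c \<A> f \<eta> p u)"

text \<open>The tangential field \<open>T\<close> and the function \<open>\<nu>\<close> in \<open>\<partial>/\<partial>t = df(T) + \<nu> \<eta>\<close>:\<close>

definition partial_t_decomposition ::
  "'m topology \<Rightarrow> ('m, 'n::finite) chart set \<Rightarrow> ('m \<Rightarrow> 'n ambient) \<Rightarrow> ('m \<Rightarrow> 'n ambient)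
     \<Rightarrow> ('m \<Rightarrow> real ^ 'n) \<Rightarrow> ('m \<Rightarrow> real) \<Rightarrow> bool" where
  "partial_t_decomposition X \<A> f \<eta> T \<nu> \<longleftrightarrow>
     (\<forall>p\<in>topspace X. partial_t = differential_at \<A> f p (T p) + \<nu> p *\<^sub>R \<eta> p)"

definition principal_curvatures_at ::
  "('m \<Rightarrow> real ^ 'n \<Rightarrow> real ^ 'n::finite) \<Rightarrow> 'm \<Rightarrow> real set" where
  "principal_curvatures_at A p = {l. \<exists>v. v \<noteq> 0 \<and> A p v = l *\<^sub>R v}"

text \<open>Geometric and algebraic multiplicities agree since shape operators are self-adjoint.\<close>

definition multiplicity_at ::
  "('m \<Rightarrow> real ^ 'n \<Rightarrow> real ^ 'n::finite) \<Rightarrow> 'm \<Rightarrow> real \<Rightarrow> nat" where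
  "multiplicity_at A p l = dim {v. A p v = l *\<^sub>R v}"

text \<open>
  \<open>\<Lambda>\<close> is the set of (distinct) principal curvatures and \<open>m\<close> gives their multiplicities, all
  independent of the point.
\<close>

definition constant_principal_curvatures ::
  "'m topology \<Rightarrow> ('m \<Rightarrow> real ^ 'n \<Rightarrow> real ^ 'n::finite) \<Rightarrow> real set \<Rightarrow> (real \<Rightarrow> nat) \<Rightarrow> bool"
where
  "constant_principal_curvatures X A \<Lambda> m \<longleftrightarrow>
     (\<forall>p\<in>topspace X. principal_curvatures_at A p = \<Lambda> \<and>
        (\<forall>l\<in>\<Lambda>. multiplicity_at A p l = m l))"

definition principal_direction ::
  "'m topology \<Rightarrow> ('m \<Rightarrow> real ^ 'n \<Rightarrow> real ^ 'n::finite) \<Rightarrow> ('m \<Rightarrow> real ^ 'n) \<Rightarrow> real \<Rightarrow> bool"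
where
  "principal_direction X A T l \<longleftrightarrow>
     (\<forall>p\<in>topspace X. T p \<noteq> 0 \<and> A p (T p) = l *\<^sub>R T p)"

end

theory Submission
  imports Defs
begin

text \<open>
  Write \<open>E\<^sub>l\<close> for the eigenspaces of \<open>A\<close>. The Codazzi equation of \<open>Q\<^sub>c \<times> \<real>\<close> reads
  \<open>(\<nabla>\<^sub>u A) v - (\<nabla>\<^sub>v A) u = c \<nu> (\<langle>v, T\<rangle> u - \<langle>u, T\<rangle> v)\<close>. As \<open>l\<close> is constant, \<open>(\<nabla>\<^sub>u A) v\<close> is orthogonal
  to \<open>E\<^sub>l\<close> for \<open>v \<in> E\<^sub>l\<close>, so the right-hand side vanishes for \<open>u, v \<in> E\<^sub>l\<close>, and \<open>T\<close> is orthogonal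
  to \<open>E\<^sub>l\<close> as soon as \<open>dim E\<^sub>l \<ge> 2\<close>. Hence \<open>A T = \<mu> T\<close> for the simple principal curvature \<open>\<mu>\<close>.
  Differentiating this with \<open>\<nabla>\<^sub>v T = \<nu> A v\<close> and pairing the Codazzi equation for a nonzero \<open>v \<in> E\<^sub>l\<close> and \<open>T\<close> with
  \<open>v\<close> gives \<open>l (\<mu> - l) = c \<langle>T, T\<rangle>\<close> at every point. If \<open>l = 0\<close>, then \<open>T\<close> vanishes identically, so
  \<open>\<nu> A v = \<nabla>\<^sub>v T = 0\<close> and \<open>\<mu> = 0 = l\<close>, which is absurd. Hence \<open>l \<noteq> 0\<close>, and then \<open>T \<noteq> 0\<close>.
\<close>

section \<open>Differential calculus\<close>

text \<open>Two mean value steps: first along \<open>u\<close> for a difference of values of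
  \<open>f\<close>, then along \<open>v\<close> for \<open>f'\<close> in the direction
  \<open>u\<close>. The left-hand side is symmetric in \<open>u\<close> and \<open>v\<close>, the
  right-hand side is not, and this will force second derivatives to commute.\<close>

lemma second_difference_mean_value:
  fixes f :: "'a::real_normed_vector \<Rightarrow> real"
  assumes f: "\<And>y. y \<in> ball x r \<Longrightarrow> (f has_derivative f' y) (at y)"
    and fu: "\<And>y. y \<in> ball x r \<Longrightarrow> ((\<lambda>z. f' z u) has_derivative f'' y) (at y)"
    and s: "0 < s" "s * (norm u + norm v) < r"
  shows "\<exists>y\<in>cball x (s * (norm u + norm v)).
           f (x + s *\<^sub>R u + s *\<^sub>R v) - f (x + s *\<^sub>R u) - f (x + s *\<^sub>R v) + f x = s\<^sup>2 * f'' y v"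
proof -
  have near: "x + a *\<^sub>R u + b *\<^sub>R v \<in> cball x (s * (norm u + norm v))"
    if "0 \<le> a" "a \<le> s" "0 \<le> b" "b \<le> s" for a b
  proof -
    have "norm (a *\<^sub>R u + b *\<^sub>R v) \<le> a * norm u + b * norm v"
      using that by (metis abs_of_nonneg norm_scaleR norm_triangle_ineq)
    also have "\<dots> \<le> s * norm u + s * norm v"
      using that by (intro add_mono mult_right_mono) auto
    finally have "norm (a *\<^sub>R u + b *\<^sub>R v) \<le> s * (norm u + norm v)"
      by (simp add: algebra_simps)
    moreover have "dist x (x + a *\<^sub>R u + b *\<^sub>R v) = norm (a *\<^sub>R u + b *\<^sub>R v)"
      by (metis add.assoc dist_add_cancel dist_0_norm add.right_neutral)
    ultimately show ?thesis by simp
  qed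
  have nb: "x + a *\<^sub>R u + b *\<^sub>R v \<in> ball x r"
    if "0 \<le> a" "a \<le> s" "0 \<le> b" "b \<le> s" for a b
    using near[OF that] s(2) by simp
  \<comment> \<open>The summand \<open>0 *\<^sub>R v\<close> gives both terms the shape covered by
    \<open>nb\<close>, so that one chain rule \<open>aff\<close> serves for both.\<close>
  define \<phi> where "\<phi> t = f (x + t *\<^sub>R u + s *\<^sub>R v) - f (x + t *\<^sub>R u + 0 *\<^sub>R v)" for t
  have d\<phi>: "(\<phi> has_derivative (\<lambda>h. h * (f' (x + t *\<^sub>R u + s *\<^sub>R v) u - f' (x + t *\<^sub>R u + 0 *\<^sub>R v) u)))
      (at t within {0..s})" if "0 \<le> t" "t \<le> s" for t
  proof -
    have lin: "linear (f' (x + t *\<^sub>R u + b *\<^sub>R v))" if "0 \<le> b" "b \<le> s" for b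
      using f[OF nb[of t b]] that \<open>0 \<le> t\<close> \<open>t \<le> s\<close> has_derivative_linear by blast
    have aff: "((\<lambda>t. f (x + t *\<^sub>R u + b *\<^sub>R v)) has_derivative
        (\<lambda>h. f' (x + t *\<^sub>R u + b *\<^sub>R v) (h *\<^sub>R u))) (at t within {0..s})" if "0 \<le> b" "b \<le> s" for b
    proof -
      have "((\<lambda>t. x + t *\<^sub>R u + b *\<^sub>R v) has_derivative (\<lambda>h. h *\<^sub>R u)) (at t within {0..s})"
        by (auto intro!: derivative_eq_intros)
      from diff_chain_within[OF this has_derivative_at_withinI[OF f[OF nb[of t b]]]]
      show ?thesis
        using that \<open>0 \<le> t\<close> \<open>t \<le> s\<close> by (simp add: o_def)
    qed
    have "(\<phi> has_derivative (\<lambda>h. f' (x + t *\<^sub>R u + s *\<^sub>R v) (h *\<^sub>R u) - f' (x + t *\<^sub>R u + 0 *\<^sub>R v) (h *\<^sub>R u)))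
       (at t within {0..s})"
      unfolding \<phi>_def using s(1) by (intro has_derivative_diff aff) auto
    then show ?thesis
      using lin[of s] lin[of 0] s(1) by (simp add: linear_scale right_diff_distrib)
  qed
  obtain \<xi> where \<xi>: "\<xi> \<in> {0<..<s}"
    "\<phi> s - \<phi> 0 = (s - 0) * (f' (x + \<xi> *\<^sub>R u + s *\<^sub>R v) u - f' (x + \<xi> *\<^sub>R u + 0 *\<^sub>R v) u)"
    using mvt_simple[OF s(1) d\<phi>] by blast
  define \<psi> where "\<psi> t = f' (x + \<xi> *\<^sub>R u + t *\<^sub>R v) u" for t
  have d\<psi>: "(\<psi> has_derivative (\<lambda>h. h * f'' (x + \<xi> *\<^sub>R u + t *\<^sub>R v) v)) (at t within {0..s})"
    if "0 \<le> t" "t \<le> s" for t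
  proof -
    have y: "x + \<xi> *\<^sub>R u + t *\<^sub>R v \<in> ball x r"
      using that \<xi>(1) by (intro nb) auto
    have lin: "linear (f'' (x + \<xi> *\<^sub>R u + t *\<^sub>R v))"
      using fu[OF y] has_derivative_linear by blast
    have "((\<lambda>t. x + \<xi> *\<^sub>R u + t *\<^sub>R v) has_derivative (\<lambda>h. h *\<^sub>R v)) (at t within {0..s})"
      by (auto intro!: derivative_eq_intros)
    from diff_chain_within[OF this has_derivative_at_withinI[OF fu[OF y]]]
    show ?thesis
      using lin by (simp add: o_def \<psi>_def[abs_def] linear_scale)
  qed
  obtain \<zeta> where \<zeta>: "\<zeta> \<in> {0<..<s}" "\<psi> s - \<psi> 0 = (s - 0) * f'' (x + \<xi> *\<^sub>R u + \<zeta> *\<^sub>R v) v"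
    using mvt_simple[OF s(1) d\<psi>] by blast
  have "\<phi> s - \<phi> 0 = s * (\<psi> s - \<psi> 0)"
    using \<xi>(2) by (simp add: \<psi>_def)
  then have "f (x + s *\<^sub>R u + s *\<^sub>R v) - f (x + s *\<^sub>R u) - f (x + s *\<^sub>R v) + f x
      = s\<^sup>2 * f'' (x + \<xi> *\<^sub>R u + \<zeta> *\<^sub>R v) v"
    using \<zeta>(2) by (simp add: \<phi>_def power2_eq_square)
  moreover have "x + \<xi> *\<^sub>R u + \<zeta> *\<^sub>R v \<in> cball x (s * (norm u + norm v))"
    using \<xi>(1) \<zeta>(1) by (intro near) auto
  ultimately show ?thesis by blast
qed

text \<open>The same second difference equals \<open>s\<^sup>2\<close> times a value of
  \<open>fu\<close> and \<open>s\<^sup>2\<close> times a value of \<open>fv\<close>, both taken near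
  \<open>x\<close>. For small \<open>s\<close> continuity at \<open>x\<close> excludes a gap between
  the two limits.\<close>

lemma symmetric_second_derivative_real:
  fixes f :: "'a::real_normed_vector \<Rightarrow> real"
  assumes "open S" "x \<in> S"
    and f: "\<And>y. y \<in> S \<Longrightarrow> (f has_derivative f' y) (at y)"
    and fu: "\<And>y. y \<in> S \<Longrightarrow> ((\<lambda>z. f' z u) has_derivative fu y) (at y)"
    and fv: "\<And>y. y \<in> S \<Longrightarrow> ((\<lambda>z. f' z v) has_derivative fv y) (at y)"
    and cu: "isCont (\<lambda>y. fu y v) x" and cv: "isCont (\<lambda>y. fv y u) x"
  shows "fu x v = fv x u"
proof (rule ccontr)
  assume ne: "fu x v \<noteq> fv x u"
  define \<epsilon> where "\<epsilon> = \<bar>fu x v - fv x u\<bar> / 2"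
  have "\<epsilon> > 0" using ne by (simp add: \<epsilon>_def)
  obtain r where r: "r > 0" "ball x r \<subseteq> S"
    using assms(1,2) openE by blast
  obtain d1 where d1: "d1 > 0" "\<And>y. dist y x < d1 \<Longrightarrow> dist (fu y v) (fu x v) < \<epsilon>"
    using cu \<open>\<epsilon> > 0\<close> unfolding continuous_at_eps_delta by blast
  obtain d2 where d2: "d2 > 0" "\<And>y. dist y x < d2 \<Longrightarrow> dist (fv y u) (fv x u) < \<epsilon>"
    using cv \<open>\<epsilon> > 0\<close> unfolding continuous_at_eps_delta by blast
  define d where "d = min r (min d1 d2)"
  have "d > 0" using r d1 d2 by (simp add: d_def)
  \<comment> \<open>The summand 1 keeps the denominator positive when \<open>u = v = 0\<close> and
    makes the bound \<open>sd\<close> strict.\<close>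
  define s where "s = d / (norm u + norm v + 1)"
  have n: "norm u + norm v + 1 > 0" by (simp add: add_nonneg_pos)
  have s: "s > 0" using \<open>d > 0\<close> n by (simp add: s_def)
  have sd: "s * (norm u + norm v) < d"
    using \<open>d > 0\<close> n by (simp add: s_def field_simps)
  then have sr: "s * (norm u + norm v) < r" "s * (norm v + norm u) < r"
    by (auto simp: d_def add.commute)
  obtain y where y: "y \<in> cball x (s * (norm u + norm v))"
    "f (x + s *\<^sub>R u + s *\<^sub>R v) - f (x + s *\<^sub>R u) - f (x + s *\<^sub>R v) + f x = s\<^sup>2 * fu y v"
    using second_difference_mean_value[of x r f f' u fu s v] f fu r(2) s sr by blast
  obtain z where z: "z \<in> cball x (s * (norm v + norm u))"
    "f (x + s *\<^sub>R v + s *\<^sub>R u) - f (x + s *\<^sub>R v) - f (x + s *\<^sub>R u) + f x = s\<^sup>2 * fv z u"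
    using second_difference_mean_value[of x r f f' v fv s u] f fv r(2) s sr by blast
  have "s\<^sup>2 * fu y v = s\<^sup>2 * fv z u"
    using y(2) z(2) by (simp add: algebra_simps)
  then have eq: "fu y v = fv z u" using s by simp
  have "dist y x < d1" "dist z x < d2"
    using y(1) z(1) sd by (auto simp: d_def dist_commute add.commute)
  then have "dist (fu y v) (fu x v) < \<epsilon>" "dist (fv z u) (fv x u) < \<epsilon>"
    using d1 d2 by auto
  then have "\<bar>fu x v - fv x u\<bar> < 2 * \<epsilon>"
    using eq by (simp add: dist_real_def)
  then show False by (simp add: \<epsilon>_def)
qed

lemma symmetric_second_derivative:
  fixes f :: "'a::real_normed_vector \<Rightarrow> 'b::euclidean_space"
  assumes "open S" "x \<in> S"
    and f: "\<And>y. y \<in> S \<Longrightarrow> (f has_derivative f' y) (at y)"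
    and fu: "\<And>y. y \<in> S \<Longrightarrow> ((\<lambda>z. f' z u) has_derivative fu y) (at y)"
    and fv: "\<And>y. y \<in> S \<Longrightarrow> ((\<lambda>z. f' z v) has_derivative fv y) (at y)"
    and cu: "isCont (\<lambda>y. fu y v) x" and cv: "isCont (\<lambda>y. fv y u) x"
  shows "fu x v = fv x u"
proof (rule euclidean_eqI)
  fix b :: 'b
  show "fu x v \<bullet> b = fv x u \<bullet> b"
  proof (rule symmetric_second_derivative_real[OF assms(1,2), of "\<lambda>y. f y \<bullet> b" "\<lambda>y h. f' y h \<bullet> b"
        u "\<lambda>y h. fu y h \<bullet> b" v "\<lambda>y h. fv y h \<bullet> b"])
  qed (auto intro!: has_derivative_inner_left f fu fv continuous_intros cu cv)
qed

lemma second_frechet_derivative_commute: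
  fixes h :: "'a::real_normed_vector \<Rightarrow> 'b::euclidean_space"
  assumes "open S" "x \<in> S" "smooth_on h S"
  shows "frechet_derivative (\<lambda>y. frechet_derivative h (at y) u) (at x) v =
         frechet_derivative (\<lambda>y. frechet_derivative h (at y) v) (at x) u"
proof -
  have "Ck_on (Suc (Suc 0)) h S" using assms(3) by (simp add: smooth_on_def)
  then show ?thesis
    using assms(1,2)
    by (intro symmetric_second_derivative[of S x h "\<lambda>y. frechet_derivative h (at y)"])
       (auto simp: frechet_derivative_works[symmetric] continuous_on_eq_continuous_at)
qed

lemma smooth_on_has_derivative:
  assumes "smooth_on h S" "x \<in> S"
  shows "(h has_derivative frechet_derivative h (at x)) (at x)"
proof -
  have "Ck_on (Suc 0) h S" using assms(1) by (simp add: smooth_on_def)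
  then show ?thesis using assms(2) by (simp add: frechet_derivative_works)
qed

lemma smooth_on_has_second_derivative:
  assumes "smooth_on h S" "x \<in> S"
  shows "((\<lambda>y. frechet_derivative h (at y) v) has_derivative
           frechet_derivative (\<lambda>y. frechet_derivative h (at y) v) (at x)) (at x)"
proof -
  have "Ck_on (Suc (Suc 0)) h S" using assms(1) by (simp add: smooth_on_def)
  then show ?thesis using assms(2) by (simp add: frechet_derivative_works)
qed

text \<open>This is the device for differentiating an identity that holds on an open set; the
  structure equations of the hypersurface below are obtained with it.\<close>

lemma derivative_unique_on_open:
  assumes "open S" "x \<in> S" "\<And>y. y \<in> S \<Longrightarrow> f y = h y"
    and "(f has_derivative f') (at x)" "(h has_derivative h') (at x)"
  shows "f' u = h' u"
  using has_derivative_unique[OF has_derivative_transform_within_open[OF assms(4,1,2,3)] assms(5)]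
  by simp

section \<open>Differentiating families of linear maps and solutions of linear equations\<close>

text \<open>A product rule for which differentiability of each \<open>L y v\<close> with
  \<open>v\<close> fixed suffices: in finite dimension \<open>L y (V y)\<close> is a finite sum over
  \<open>Basis\<close>.\<close>

lemma has_derivative_linear_family_apply:
  fixes L :: "'a::real_normed_vector \<Rightarrow> 'c::euclidean_space \<Rightarrow> 'b::real_normed_vector"
  assumes lin: "\<forall>\<^sub>F y in nhds x. linear (L y)"
    and L: "\<And>v. ((\<lambda>y. L y v) has_derivative (\<lambda>u. L' u v)) (at x)"
    and V: "(V has_derivative V') (at x)"
  shows "((\<lambda>y. L y (V y)) has_derivative (\<lambda>u. L' u (V x) + L x (V' u))) (at x)"
proof -
  have lin_at: "\<forall>\<^sub>F y in at x. linear (L y)" and linx: "linear (L x)"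
    using lin by (auto simp: eventually_nhds_conv_at)
  \<comment> \<open>Linearity of \<open>L' u\<close> is inherited from that of \<open>L y\<close>,
    by uniqueness of derivatives.\<close>
  have uniq: "L' u v = h u"
    if "(H has_derivative h) (at x)" "\<And>y. linear (L y) \<Longrightarrow> H y = L y v" for H h u v
  proof -
    have "\<forall>\<^sub>F y in at x. H y = L y v"
      using lin_at by eventually_elim (use that in simp)
    then have "((\<lambda>y. L y v) has_derivative h) (at x)"
      using that linx by (auto intro: has_derivative_transform_eventually[OF that(1)])
    then show ?thesis using has_derivative_unique[OF L[of v]] by (simp add: fun_eq_iff)
  qed
  have L'_add: "L' u (v + w) = L' u v + L' u w" for u v w
    by (rule uniq[OF has_derivative_add[OF L L]]) (simp add: linear_add)
  have L'_scale: "L' u (a *\<^sub>R v) = a *\<^sub>R L' u v" for u a v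
    by (rule uniq[OF has_derivative_scaleR_right[OF L]]) (simp add: linear_scale)
  have lin': "linear (L' u)" for u
    by (intro linearI L'_add L'_scale)
  have expand: "M v = (\<Sum>b\<in>Basis. (v \<bullet> b) *\<^sub>R M b)" if "linear M" for M :: "'c \<Rightarrow> 'b" and v
  proof -
    have "M v = M (\<Sum>b\<in>Basis. (v \<bullet> b) *\<^sub>R b)" by (simp add: euclidean_representation)
    then show ?thesis using that by (simp add: linear_sum linear_scale)
  qed
  have "((\<lambda>y. \<Sum>b\<in>Basis. (V y \<bullet> b) *\<^sub>R L y b) has_derivative
      (\<lambda>u. \<Sum>b\<in>Basis. (V x \<bullet> b) *\<^sub>R L' u b + (V' u \<bullet> b) *\<^sub>R L x b)) (at x)"
    by (intro has_derivative_sum has_derivative_scaleR has_derivative_inner_left V L)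
  then have "((\<lambda>y. \<Sum>b\<in>Basis. (V y \<bullet> b) *\<^sub>R L y b) has_derivative
      (\<lambda>u. L' u (V x) + L x (V' u))) (at x)"
    by (simp add: sum.distrib flip: expand[OF lin'] expand[OF linx])
  moreover have "\<forall>\<^sub>F y in at x. (\<Sum>b\<in>Basis. (V y \<bullet> b) *\<^sub>R L y b) = L y (V y)"
    using lin_at by eventually_elim (simp flip: expand)
  ultimately show ?thesis
    using linx by (auto intro: has_derivative_transform_eventually simp flip: expand)
qed

text \<open>With a left inverse \<open>R\<close> of \<open>L x\<close>, the map
  \<open>R \<circ> L y\<close> is close to the identity, so \<open>Z y - Z x\<close> differs little
  from \<open>k y = R (w y - L y (Z x))\<close>, which is differentiable. This yields
  differentiability of fields that are known only through their images under
  \<open>DF\<close>.\<close>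

lemma differentiable_linear_solution:
  fixes L :: "'a::real_normed_vector \<Rightarrow> 'c::euclidean_space \<Rightarrow> 'b::euclidean_space"
  assumes lin: "\<forall>\<^sub>F y in nhds x. linear (L y)"
    and L: "\<And>v. (\<lambda>y. L y v) differentiable (at x)"
    and inj: "inj (L x)"
    and sol: "\<forall>\<^sub>F y in nhds x. L y (Z y) = w y"
    and w: "w differentiable (at x)"
  shows "Z differentiable (at x)"
proof -
  have linx: "linear (L x)" and solx: "L x (Z x) = w x"
    using lin sol by (auto simp: eventually_nhds_conv_at)
  obtain R where R: "linear R" "R \<circ> L x = id"
    using linear_injective_left_inverse[OF linx inj] by blast
  then have bR: "bounded_linear R" by (simp add: linear_conv_bounded_linear)
  have diff_R: "(\<lambda>y. R (h y)) differentiable (at x)" if "h differentiable (at x)" for h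
    using that bounded_linear.has_derivative[OF bR] unfolding differentiable_def by blast
  have Rx: "R (L x v) = v" for v using R(2) by (metis comp_apply id_apply)
  define k where "k y = R (w y - L y (Z x))" for y
  have "k differentiable (at x)"
    unfolding k_def by (intro diff_R differentiable_diff w L)
  then obtain k' where k': "(k has_derivative k') (at x)"
    by (auto simp: differentiable_def)
  have bk: "bounded_linear k'" using k' has_derivative_bounded_linear by blast
  obtain K where K: "K > 0" "\<And>h. norm (k' h) \<le> norm h * K"
    using bounded_linear.pos_bounded[OF bk] by blast
  have kx: "k x = 0" by (simp add: k_def solx linear_0 R(1))
  \<comment> \<open>Convergence on the finitely many basis vectors gives a bound uniform in
    \<open>v\<close>; hence the division by \<open>DIM('c)\<close> below.\<close>
  have close: "\<forall>\<^sub>F y in at x. \<forall>v. norm (R (L y v) - v) \<le> \<delta> * norm v" if "\<delta> > 0" for \<delta> :: real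
  proof -
    define \<delta>' where "\<delta>' = \<delta> / real DIM('c)"
    have "\<delta>' > 0" using that by (simp add: \<delta>'_def)
    have "\<forall>\<^sub>F y in at x. dist (R (L y b)) b < \<delta>'" for b
    proof -
      have "isCont (\<lambda>y. R (L y b)) x"
        using diff_R[OF L[of b]] differentiable_imp_continuous_within by blast
      then have "((\<lambda>y. R (L y b)) \<longlongrightarrow> b) (at x)"
        by (simp add: isCont_def Rx)
      then show ?thesis using \<open>\<delta>' > 0\<close> tendstoD by blast
    qed
    then have "\<forall>\<^sub>F y in at x. \<forall>b\<in>Basis. dist (R (L y b)) b < \<delta>'"
      by (simp add: eventually_ball_finite_distrib)
    moreover have "\<forall>\<^sub>F y in at x. linear (L y)"
      using lin by (simp add: eventually_nhds_conv_at)
    ultimately show ?thesis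
    proof eventually_elim
      case (elim y)
      show ?case
      proof
        fix v
        have linE: "linear (\<lambda>v. R (L y v) - v)"
          using linear_compose_sub[OF linear_compose[OF elim(2) R(1)] linear_id]
          by (simp add: o_def)
        have "R (L y v) - v = (\<lambda>v. R (L y v) - v) (\<Sum>b\<in>Basis. (v \<bullet> b) *\<^sub>R b)"
          by (simp add: euclidean_representation)
        also have "\<dots> = (\<Sum>b\<in>Basis. (v \<bullet> b) *\<^sub>R (R (L y b) - b))"
          unfolding linear_sum[OF linE] linear_scale[OF linE] ..
        also have "norm \<dots> \<le> (\<Sum>b::'c\<in>Basis. norm v * \<delta>')"
        proof (rule sum_norm_le)
          fix b :: 'c assume "b \<in> Basis"
          then show "norm ((v \<bullet> b) *\<^sub>R (R (L y b) - b)) \<le> norm v * \<delta>'"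
            using elim(1) unfolding norm_scaleR real_norm_def dist_norm
            by (intro mult_mono Basis_le_norm) (auto intro: less_imp_le)
        qed
        finally show "norm (R (L y v) - v) \<le> \<delta> * norm v"
          by (simp add: \<delta>'_def mult.commute)
      qed
    qed
  qed
  have "((\<lambda>y. Z y - Z x) has_derivative k') (at x)"
    unfolding has_derivative_within_alt2
  proof (intro conjI allI impI bk)
    fix e :: real assume "e > 0"
    \<comment> \<open>The bound 1/2 allows \<open>\<delta> * norm Y\<close> to be absorbed, which
      yields \<open>norm Y \<le> 2 * (K + 1) * n\<close>; the other bound then turns
      \<open>\<delta> * norm Y\<close> into at most \<open>e/2 * n\<close>.\<close>
    define \<delta> where "\<delta> = min (1/2) (e / (4 * (K + 1)))"
    have \<delta>: "\<delta> > 0" "\<delta> \<le> 1/2" "\<delta> \<le> e / (4 * (K + 1))"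
      using \<open>e > 0\<close> K(1) unfolding \<delta>_def by (simp_all only: min.cobounded1 min.cobounded2) simp
    have \<delta>e: "\<delta> * (2 * (K + 1)) \<le> e / 2"
      using \<delta>(3) K(1) by (simp add: field_simps)
    define e1 where "e1 = min (e/2) 1"
    have e1: "e1 > 0" "e1 \<le> e/2" "e1 \<le> 1" using \<open>e > 0\<close> by (auto simp: e1_def)
    have "\<forall>\<^sub>F y in at x. norm (k y - k x - k' (y - x)) \<le> e1 * norm (y - x)"
      using k' e1(1) unfolding has_derivative_within_alt2 by blast
    moreover have "\<forall>\<^sub>F y in at x. \<forall>v. norm (R (L y v) - v) \<le> \<delta> * norm v"
      by (rule close[OF \<delta>(1)])
    moreover have "\<forall>\<^sub>F y in at x. linear (L y)" "\<forall>\<^sub>F y in at x. L y (Z y) = w y"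
      using lin sol by (auto simp: eventually_nhds_conv_at)
    ultimately show "\<forall>\<^sub>F y in at x. norm (Z y - Z x - (Z x - Z x) - k' (y - x)) \<le> e * norm (y - x)"
    proof eventually_elim
      case (elim y)
      define Y where "Y = Z y - Z x"
      define n where "n = norm (y - x)"
      have "R (L y Y) = k y"
        using elim(3,4) by (simp add: Y_def k_def linear_diff)
      then have YK: "norm (k y - Y) \<le> \<delta> * norm Y"
        using elim(2) by metis
      have kk: "norm (k y - k' (y - x)) \<le> e1 * n"
        using elim(1) by (simp add: kx n_def)
      have "norm (k y) \<le> norm (k y - k' (y - x)) + norm (k' (y - x))"
        by (metis diff_add_cancel norm_triangle_ineq)
      also have "\<dots> \<le> 1 * n + n * K"
        using order_trans[OF kk mult_right_mono[OF e1(3)]] K(2)[of "y - x"] unfolding n_def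
        by (intro add_mono) auto
      finally have nk: "norm (k y) \<le> (K + 1) * n" by (simp add: algebra_simps)
      have "norm Y \<le> norm (k y) + norm (k y - Y)"
        by (metis norm_triangle_sub norm_minus_commute)
      also have "\<dots> \<le> norm (k y) + 1/2 * norm Y"
        using YK \<delta>(2) by (smt (verit) mult_right_mono norm_ge_zero)
      finally have "norm Y \<le> 2 * (K + 1) * n" using nk by (simp add: algebra_simps)
      then have "norm (k y - Y) \<le> \<delta> * (2 * (K + 1) * n)"
        using YK \<delta>(1) by (smt (verit) mult_left_mono)
      also have "\<dots> \<le> e/2 * n"
        using \<delta>e mult_right_mono[OF \<delta>e, of n] by (simp add: n_def mult.assoc)
      finally have "norm (k y - Y) \<le> e/2 * n" .
      moreover have "norm (k y - k' (y - x)) \<le> e/2 * n"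
        using kk e1(2) by (smt (verit) mult_right_mono n_def norm_ge_zero)
      moreover have "norm (Y - k' (y - x)) \<le> norm (k y - k' (y - x)) + norm (k y - Y)"
        by (metis (no_types, opaque_lifting) add.commute diff_add_cancel diff_diff_eq2 norm_minus_commute norm_triangle_ineq norm_triangle_ineq4 add_diff_cancel_left' diff_add_eq)
      ultimately show ?case by (simp add: Y_def n_def)
    qed
  qed
  then have "((\<lambda>y. (Z y - Z x) + Z x) has_derivative (\<lambda>h. k' h + 0)) (at x)"
    by (intro has_derivative_add has_derivative_const)
  then show ?thesis by (auto simp: differentiable_def)
qed

section \<open>Self-adjoint operators\<close>

text \<open>The polynomial has a minimum at 0, so its derivative there vanishes. Explicitly,
  \<open>t = - a / d\<close> with \<open>d > b\<close> positive would make it negative if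
  \<open>a\<close> were nonzero.\<close>

lemma linear_coefficient_eq_0:
  fixes a b :: real
  assumes "\<And>t. 0 \<le> t * a + t\<^sup>2 * b"
  shows "a = 0"
proof (rule ccontr)
  assume "a \<noteq> 0"
  define d where "d = \<bar>b\<bar> + 1"
  have d: "d > 0" "b < d" by (auto simp: d_def)
  have "0 \<le> (- a / d) * a + (- a / d)\<^sup>2 * b" by (rule assms)
  also have "\<dots> = (a\<^sup>2 / d\<^sup>2) * (b - d)"
    using d(1) by (simp add: field_simps power2_eq_square)
  also have "\<dots> < 0"
    using \<open>a \<noteq> 0\<close> d by (intro mult_pos_neg) auto
  finally show False by simp
qed

text \<open>\<open>g\<close> stands for the metric at one point and generally differs from the inner
  product built into the type, which serves only for norms, topology and bases.\<close>

locale self_adjoint =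
  fixes g :: "'a::euclidean_space \<Rightarrow> 'a \<Rightarrow> real" and A :: "'a \<Rightarrow> 'a"
  assumes bilinear: "bilinear g" and sym: "g u v = g v u"
    and pos: "u \<noteq> 0 \<Longrightarrow> 0 < g u u"
    and linear: "linear A" and self_adjoint: "g (A u) v = g u (A v)"
begin

lemmas bilinear_rules = bilinear_ladd[OF bilinear] bilinear_radd[OF bilinear]
  bilinear_lmul[OF bilinear] bilinear_rmul[OF bilinear] bilinear_lsub[OF bilinear]
  bilinear_rsub[OF bilinear] bilinear_lzero[OF bilinear] bilinear_rzero[OF bilinear]

lemma eq_0_iff: "g u u = 0 \<longleftrightarrow> u = 0"
  using pos[of u] bilinear_rules(7) by fastforce

lemma eigenvectors_orthogonal:
  assumes "A u = k *\<^sub>R u" "A v = l *\<^sub>R v" "k \<noteq> l"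
  shows "g u v = 0"
proof -
  have "k * g u v = l * g u v"
    using self_adjoint[of u v] assms by (simp add: bilinear_rules)
  then show ?thesis using assms(3) by simp
qed

text \<open>Eigenvectors for distinct eigenvalues are \<open>g\<close>-orthogonal, hence
  independent, so there are at most \<open>DIM('a)\<close> eigenvalues.\<close>

lemma finite_eigenvalues: "finite {l. \<exists>v. v \<noteq> 0 \<and> A v = l *\<^sub>R v}"
proof (rule ccontr)
  assume "infinite {l. \<exists>v. v \<noteq> 0 \<and> A v = l *\<^sub>R v}"
  from infinite_arbitrarily_large[OF this, of "Suc DIM('a)"]
  obtain S where S: "finite S" "card S = Suc DIM('a)" "S \<subseteq> {l. \<exists>v. v \<noteq> 0 \<and> A v = l *\<^sub>R v}"
    by auto
  then have "\<forall>l\<in>S. \<exists>v. v \<noteq> 0 \<and> A v = l *\<^sub>R v" by blast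
  from bchoice[OF this] obtain v where v: "\<And>l. l \<in> S \<Longrightarrow> v l \<noteq> 0 \<and> A (v l) = l *\<^sub>R v l"
    by blast
  have orth: "g (v k) (v l) = 0" if "k \<in> S" "l \<in> S" "k \<noteq> l" for k l
    using eigenvectors_orthogonal v that by blast
  have "inj_on v S"
    by (rule inj_onI) (use orth v eq_0_iff in metis)
  have "independent (v ` S)"
  proof
    assume "dependent (v ` S)"
    then obtain u w where w: "w \<in> v ` S" "u w \<noteq> 0" "(\<Sum>x\<in>v ` S. u x *\<^sub>R x) = 0"
      using dependent_finite[of "v ` S"] S(1) by auto
    then obtain l where l: "l \<in> S" "w = v l" by blast
    have "0 = g (\<Sum>k\<in>S. u (v k) *\<^sub>R v k) w"
      using w(3) \<open>inj_on v S\<close> by (simp add: sum.reindex bilinear_rules)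
    also have "\<dots> = (\<Sum>k\<in>S. g (u (v k) *\<^sub>R v k) w)"
      using bilinear unfolding bilinear_def by (intro linear_sum) blast
    also have "\<dots> = (\<Sum>k\<in>S. if k = l then u w * g w w else 0)"
      using orth l by (intro sum.cong) (auto simp: bilinear_rules)
    also have "\<dots> = u w * g w w" using l S(1) by simp
    finally show False using w(2) v[OF l(1)] l(2) by (simp add: eq_0_iff)
  qed
  then have "card (v ` S) \<le> DIM('a)" using independent_bound by blast
  then show False using S(2) \<open>inj_on v S\<close> by (simp add: card_image)
qed

text \<open>
  Otherwise the Rayleigh quotient attains a maximum on the invariant subspace of all such
  vectors, and a maximum point is an eigenvector orthogonal to itself.
\<close>

lemma orthogonal_to_eigenvectors_imp_0:
  assumes z: "\<And>l e. A e = l *\<^sub>R e \<Longrightarrow> g z e = 0"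
  shows "z = 0"
proof (rule ccontr)
  assume "z \<noteq> 0"
  define E where "E = {e. \<exists>l. A e = l *\<^sub>R e}"
  define W where "W = {w. \<forall>e\<in>E. g w e = 0}"
  have W_scale: "a *\<^sub>R w \<in> W" if "w \<in> W" for a w
    using that by (simp add: W_def bilinear_rules)
  have W_add: "v + w \<in> W" if "v \<in> W" "w \<in> W" for v w
    using that by (simp add: W_def bilinear_rules)
  have W_diff: "v - w \<in> W" if "v \<in> W" "w \<in> W" for v w
    using that by (simp add: W_def bilinear_rules)
  have W_A: "A w \<in> W" if "w \<in> W" for w
    using that by (auto simp: W_def E_def self_adjoint bilinear_rules)
  have "z \<in> W" using z by (auto simp: W_def E_def)
  have cont_g: "continuous_on S (\<lambda>x. g (a x) (b x))"
    if "continuous_on S a" "continuous_on S b" for S :: "'a set" and a b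
    using bilinear that bilinear_conv_bounded_bilinear bounded_bilinear.continuous_on by blast
  have cont_A: "continuous_on S A" for S
    by (rule linear_continuous_on_compose[OF continuous_on_id linear])
  have "closed {w. g w e = 0}" for e
    by (intro closed_Collect_eq cont_g continuous_intros)
  moreover have "W = (\<Inter>e\<in>E. {w. g w e = 0})" by (auto simp: W_def)
  ultimately have "closed W" by auto
  then have "compact (sphere 0 1 \<inter> W)"
    by (simp add: compact_Int_closed)
  moreover have "(1 / norm z) *\<^sub>R z \<in> sphere 0 1 \<inter> W"
    using \<open>z \<noteq> 0\<close> \<open>z \<in> W\<close> W_scale by auto
  then have "sphere 0 1 \<inter> W \<noteq> {}" by blast
  moreover have "continuous_on (sphere 0 1 \<inter> W) (\<lambda>w. g (A w) w / g w w)"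
    by (intro continuous_on_divide cont_g cont_A continuous_on_id) (auto simp: eq_0_iff)
  ultimately have "\<exists>w\<in>sphere 0 1 \<inter> W. \<forall>v\<in>sphere 0 1 \<inter> W. g (A v) v / g v v \<le> g (A w) w / g w w"
    by (rule continuous_attains_sup)
  then obtain w0 where w0: "norm w0 = 1" "w0 \<in> W"
    and max: "\<And>w. norm w = 1 \<Longrightarrow> w \<in> W \<Longrightarrow> g (A w) w / g w w \<le> g (A w0) w0 / g w0 w0"
    by auto
  define l where "l = g (A w0) w0 / g w0 w0"
  have "w0 \<noteq> 0" using w0(1) by auto
  have le: "g (A w) w \<le> l * g w w" if "w \<in> W" for w
  proof (cases "w = 0")
    case True
    then show ?thesis by (simp add: bilinear_rules)
  next
    case False
    let ?w = "(1 / norm w) *\<^sub>R w"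
    have "g (A ?w) ?w / g ?w ?w \<le> l"
      unfolding l_def using False that W_scale by (intro max) auto
    moreover have "g (A ?w) ?w / g ?w ?w = g (A w) w / g w w"
      using False by (simp add: linear_scale[OF linear] bilinear_rules)
    ultimately show ?thesis using pos[OF False] by (simp add: field_simps)
  qed
  \<comment> \<open>By maximality of \<open>l\<close> this form is nonnegative on the diagonal of
    \<open>W\<close>, and it vanishes at \<open>w0\<close>. So its first variation at
    \<open>w0\<close> is zero in all directions of \<open>W\<close>, among them
    \<open>l *\<^sub>R w0 - A w0\<close>.\<close>
  define q where "q u v = l * g u v - g (A u) v" for u v
  have q0: "q w0 w0 = 0"
    using \<open>w0 \<noteq> 0\<close> by (simp add: q_def l_def eq_0_iff)
  have q_orth: "q w0 w = 0" if "w \<in> W" for w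
  proof -
    have "0 \<le> t * (2 * q w0 w) + t\<^sup>2 * q w w" for t
    proof -
      have "0 \<le> q (w0 + t *\<^sub>R w) (w0 + t *\<^sub>R w)"
        using le[of "w0 + t *\<^sub>R w"] w0(2) that W_add W_scale by (simp add: q_def)
      also have "\<dots> = q w0 w0 + t * (2 * q w0 w) + t\<^sup>2 * q w w"
        using sym[of w w0] sym[of "A w" w0] self_adjoint[of w0 w]
        by (simp add: q_def linear_add[OF linear] linear_scale[OF linear] bilinear_rules
            power2_eq_square algebra_simps)
      finally show ?thesis by (simp add: q0)
    qed
    then show ?thesis using linear_coefficient_eq_0 by fastforce
  qed
  have "g (l *\<^sub>R w0 - A w0) w = q w0 w" for w
    by (simp add: q_def bilinear_rules)
  moreover have "q w0 (l *\<^sub>R w0 - A w0) = 0" by (intro q_orth W_diff W_scale W_A w0(2))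
  ultimately have "g (l *\<^sub>R w0 - A w0) (l *\<^sub>R w0 - A w0) = 0" by metis
  then have "A w0 = l *\<^sub>R w0" by (simp add: eq_0_iff)
  then have "g w0 w0 = 0" using w0(2) by (auto simp: W_def E_def)
  then show False using \<open>w0 \<noteq> 0\<close> by (simp add: eq_0_iff)
qed

section \<open>Polynomials in a self-adjoint operator\<close>

text \<open>The \<open>foldr\<close> applies the polynomial with roots \<open>ks\<close> to the
  operator; on an eigenvector it multiplies by the value of that polynomial at the
  eigenvalue.\<close>

lemma product_of_shifts_eigenvector:
  "A v = l *\<^sub>R v \<Longrightarrow>
    foldr (\<lambda>k z. A z - k *\<^sub>R z) ks v = (\<Prod>k\<leftarrow>ks. l - k) *\<^sub>R v"
  by (induction ks) (simp_all add: linear_scale[OF linear] algebra_simps)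

lemma product_of_shifts_orthogonal:
  "A e = l *\<^sub>R e \<Longrightarrow>
    g (foldr (\<lambda>k z. A z - k *\<^sub>R z) ks v) e = (\<Prod>k\<leftarrow>ks. l - k) * g v e"
  by (induction ks) (simp_all add: self_adjoint bilinear_rules algebra_simps)

text \<open>One more factor for \<open>l\<close> makes the polynomial vanish at every eigenvalue, so
  the resulting vector is orthogonal to all eigenvectors and is zero. The product thus maps into the
  \<open>l\<close>-eigenspace without any choice of a basis.\<close>

lemma product_of_shifts_in_eigenspace:
  assumes "\<And>k e. A e = k *\<^sub>R e \<Longrightarrow> e \<noteq> 0 \<Longrightarrow> k = l \<or> k \<in> set ks"
  shows "A (foldr (\<lambda>k z. A z - k *\<^sub>R z) ks v) = l *\<^sub>R foldr (\<lambda>k z. A z - k *\<^sub>R z) ks v"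
proof -
  have "g (foldr (\<lambda>k z. A z - k *\<^sub>R z) (l # ks) v) e = 0" if e: "A e = k *\<^sub>R e" for k e
  proof (cases "e = 0")
    case False
    then have "(\<Prod>k'\<leftarrow>l # ks. k - k') = 0"
      using assms[OF e] by (auto simp: prod_list_zero_iff image_iff)
    then show ?thesis using product_of_shifts_orthogonal[OF e, of "l # ks" v] by simp
  qed (simp add: bilinear_rules)
  then have "foldr (\<lambda>k z. A z - k *\<^sub>R z) (l # ks) v = 0"
    by (rule orthogonal_to_eigenvectors_imp_0)
  then show ?thesis by simp
qed

lemma single_eigenvalue_imp_homothety:
  assumes "\<And>l e. A e = l *\<^sub>R e \<Longrightarrow> e \<noteq> 0 \<Longrightarrow> l = \<mu>"
  shows "A z = \<mu> *\<^sub>R z"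
proof -
  have "g (A z - \<mu> *\<^sub>R z) e = 0" if e: "A e = k *\<^sub>R e" for k e
    using assms[OF e] by (cases "e = 0") (simp_all add: bilinear_rules self_adjoint e)
  then have "A z - \<mu> *\<^sub>R z = 0" by (rule orthogonal_to_eigenvectors_imp_0)
  then show ?thesis by simp
qed

end

section \<open>Hypersurfaces in coordinates\<close>

lemma bilinear_ambient_form: "bilinear (ambient_form c)"
  unfolding bilinear_def ambient_form_def
  by (auto intro!: linearI simp: split_beta inner_add_left inner_add_right algebra_simps)

lemma ambient_form_commute: "ambient_form c v w = ambient_form c w v"
  by (simp add: ambient_form_def split_beta inner_commute mult_ac)

lemmas ambient_form_simps =
  bilinear_ladd[OF bilinear_ambient_form] bilinear_radd[OF bilinear_ambient_form]
  bilinear_lsub[OF bilinear_ambient_form] bilinear_rsub[OF bilinear_ambient_form]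
  bilinear_lmul[OF bilinear_ambient_form] bilinear_rmul[OF bilinear_ambient_form]
  bilinear_lneg[OF bilinear_ambient_form] bilinear_rneg[OF bilinear_ambient_form]
  bilinear_lzero[OF bilinear_ambient_form] bilinear_rzero[OF bilinear_ambient_form]

lemma has_derivative_ambient_form:
  assumes "(a has_derivative a') (at x)" "(b has_derivative b') (at x)"
  shows "((\<lambda>y. ambient_form c (a y) (b y)) has_derivative
    (\<lambda>u. ambient_form c (a x) (b' u) + ambient_form c (a' u) (b x))) (at x)"
  using bounded_bilinear.FDERIV[OF _ assms] bilinear_ambient_form bilinear_conv_bounded_bilinear
  by blast

lemma bounded_linear_position_normal: "bounded_linear (position_normal :: 'n::finite ambient \<Rightarrow> _)"
  unfolding linear_conv_bounded_linear[symmetric] position_normal_def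
  by (auto intro!: linearI)

text \<open>\<open>position_normal\<close> drops the component along the factor \<real>, which is
  recovered by pairing with \<open>partial_t\<close>. The terms in \<open>\<theta>\<close> and
  \<open>\<nu>\<close> below arise from this correction.\<close>

lemma ambient_form_position_normal:
  "ambient_form c v (position_normal w) =
     ambient_form c v w - ambient_form c v partial_t * ambient_form c w partial_t"
  by (simp add: ambient_form_def split_beta position_normal_def partial_t_def)

lemma position_normal_partial_t [simp]:
  "ambient_form c (position_normal v) partial_t = 0"
  "ambient_form c partial_t (position_normal v) = 0"
  "ambient_form c partial_t partial_t = 1"
  by (simp_all add: ambient_form_def split_beta position_normal_def partial_t_def)

lemma ambient_form_position_normal_eq:
  "v \<in> product_space c \<Longrightarrow> ambient_form c (position_normal v) (position_normal v) = c"
  by (auto simp: product_space_def space_form_def ambient_form_def split_beta position_normal_def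
      power2_eq_square)

text \<open>The hypersurface in the coordinates of one chart. \<open>A\<close>, \<open>T\<close> and
  \<open>\<nu>\<close> enter through pointwise equations only; their differentiability is derived
  from the smoothness of \<open>F\<close> and \<open>N\<close>.\<close>

locale local_hypersurface =
  fixes c :: real and \<Omega> :: "(real ^ 'n::finite) set" and F N :: "real ^ 'n \<Rightarrow> 'n ambient"
    and A :: "real ^ 'n \<Rightarrow> real ^ 'n \<Rightarrow> real ^ 'n" and T :: "real ^ 'n \<Rightarrow> real ^ 'n"
    and \<nu> :: "real ^ 'n \<Rightarrow> real"
  assumes c_nonzero: "c \<noteq> 0" and open_\<Omega>: "open \<Omega>" and smooth_F: "smooth_on F \<Omega>" and smooth_N: "smooth_on N \<Omega>"
    and F_in: "x \<in> \<Omega> \<Longrightarrow> F x \<in> product_space c"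
    and metric_pos: "x \<in> \<Omega> \<Longrightarrow> v \<noteq> 0 \<Longrightarrow>
      0 < ambient_form c (frechet_derivative F (at x) v) (frechet_derivative F (at x) v)"
    and N_tangent: "x \<in> \<Omega> \<Longrightarrow> ambient_form c (N x) (position_normal (F x)) = 0"
    and N_unit: "x \<in> \<Omega> \<Longrightarrow> ambient_form c (N x) (N x) = 1"
    and N_normal: "x \<in> \<Omega> \<Longrightarrow> ambient_form c (N x) (frechet_derivative F (at x) v) = 0"
    and Weingarten: "x \<in> \<Omega> \<Longrightarrow> frechet_derivative F (at x) (A x v) =
      - product_tangent_proj c (F x) (frechet_derivative N (at x) v)"
    and decomposition: "x \<in> \<Omega> \<Longrightarrow> partial_t = frechet_derivative F (at x) (T x) + \<nu> x *\<^sub>R N x"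
    and \<nu>_nonzero: "x \<in> \<Omega> \<Longrightarrow> \<nu> x \<noteq> 0"
begin

abbreviation DF where "DF x v \<equiv> frechet_derivative F (at x) v"
abbreviation DN where "DN x v \<equiv> frechet_derivative N (at x) v"
abbreviation D2F where "D2F x u v \<equiv> frechet_derivative (\<lambda>y. DF y v) (at x) u"
abbreviation D2N where "D2N x u v \<equiv> frechet_derivative (\<lambda>y. DN y v) (at x) u"
abbreviation B where "B \<equiv> ambient_form c"
abbreviation P where "P x \<equiv> position_normal (F x)"

text \<open>\<open>G\<close> and \<open>h\<close> are the first and second fundamental forms,
  \<open>K\<close> the Christoffel symbols of the first kind of \<open>G\<close>, and
  \<open>\<theta>\<close> the one-form dual to \<open>T\<close>.\<close>

definition G where "G x v w = B (DF x v) (DF x w)"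
definition h where "h x v w = - B (DN x v) (DF x w)"
definition K where "K x u v w = B (D2F x u v) (DF x w)"
definition \<theta> where "\<theta> x v = B (DF x v) partial_t"

text \<open>
  This is \<open>\<langle>(\<nabla>\<^sub>u A) v, w\<rangle>\<close>, written without derivatives of \<open>A\<close>: it comes from differentiating
  \<open>DN v = - DF (A v) + c \<nu> \<theta>(v) P\<close> and pairing with \<open>DF w\<close>.
\<close>

definition C where "C x u v w = - B (D2N x u v) (DF x w) - K x u v (A x w)
  + c * \<nu> x * \<theta> x v * (G x u w - \<theta> x u * \<theta> x w)"

context
  fixes x assumes x: "x \<in> \<Omega>"
begin

lemmas F_derivative = smooth_on_has_derivative[OF smooth_F x]
  and N_derivative = smooth_on_has_derivative[OF smooth_N x]
  and DF_derivative = smooth_on_has_second_derivative[OF smooth_F x]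
  and DN_derivative = smooth_on_has_second_derivative[OF smooth_N x]

lemmas linear_DF = has_derivative_linear[OF F_derivative]
  and linear_DN = has_derivative_linear[OF N_derivative]

lemmas DF_simps = linear_add[OF linear_DF] linear_diff[OF linear_DF] linear_scale[OF linear_DF]
  linear_0[OF linear_DF]
lemmas DN_simps = linear_add[OF linear_DN] linear_diff[OF linear_DN] linear_scale[OF linear_DN]
  linear_0[OF linear_DN]

section \<open>Structure equations of the immersion\<close>

lemma P_derivative: "(P has_derivative (\<lambda>u. position_normal (DF x u))) (at x)"
  by (rule bounded_linear.has_derivative[OF bounded_linear_position_normal F_derivative])

lemma D2F_commute: "D2F x u v = D2F x v u"
  by (rule second_frechet_derivative_commute[OF open_\<Omega> x smooth_F])

lemma D2N_commute: "D2N x u v = D2N x v u"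
  by (rule second_frechet_derivative_commute[OF open_\<Omega> x smooth_N])

lemma eventually_in_\<Omega>: "\<forall>\<^sub>F y in nhds x. y \<in> \<Omega>"
  using open_\<Omega> x by (rule eventually_nhds_in_open)

text \<open>Derivative of \<open>B (P y) (P y) = c\<close>; since \<open>P x\<close> has no
  component along \<real>, the projection of \<open>DF x u\<close> may be replaced by
  \<open>DF x u\<close>.\<close>

lemma P_orthogonal: "B (DF x u) (P x) = 0"
proof -
  have "B (P x) (position_normal (DF x u)) + B (position_normal (DF x u)) (P x) = 0"
    by (rule derivative_unique_on_open[OF open_\<Omega> x _
          has_derivative_ambient_form[OF P_derivative P_derivative] has_derivative_const[of c]])
       (simp add: ambient_form_position_normal_eq F_in)
  then show ?thesis
    using ambient_form_commute[of c "P x" "position_normal (DF x u)"]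
      ambient_form_commute[of c "P x" "DF x u"]
    by (simp add: ambient_form_position_normal[of c "P x" "DF x u"])
qed

lemma N_partial_t: "B (N x) partial_t = \<nu> x"
  using arg_cong[OF decomposition[OF x], of "B (N x)"] N_normal[OF x, of "T x"] N_unit[OF x]
  by (simp add: ambient_form_simps)

lemma DF_eq_0_iff: "DF x v = 0 \<longleftrightarrow> v = 0"
  using metric_pos[OF x, of v] by (cases "v = 0") (auto simp: ambient_form_simps DF_simps)

lemma inj_DF: "inj (DF x)"
  using DF_eq_0_iff linear_injective_0[OF linear_DF] by blast

text \<open>Derivative of \<open>B (N y) (P y) = 0\<close>: \<open>N x\<close> is orthogonal to
  \<open>DF x u\<close>, but not to its part along \<open>Q\<^sub>c\<close>, and the defect is the
  product on the right.\<close>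

lemma DN_P: "B (DN x u) (P x) = \<theta> x u * \<nu> x"
proof -
  have "B (N x) (position_normal (DF x u)) + B (DN x u) (P x) = 0"
    by (rule derivative_unique_on_open[OF open_\<Omega> x _
          has_derivative_ambient_form[OF N_derivative P_derivative] has_derivative_const[of 0]])
       (simp add: N_tangent)
  then show ?thesis
    by (simp add: ambient_form_position_normal N_normal[OF x] N_partial_t \<theta>_def)
qed

text \<open>The Weingarten formula for the flat derivative. Its component along \<open>P x\<close>
  is the source of the curvature term in the Codazzi equation.\<close>

lemma DF_A: "DF x (A x u) = - DN x u + (c * \<nu> x * \<theta> x u) *\<^sub>R P x"
  using Weingarten[OF x, of u] by (simp add: product_tangent_proj_def DN_P mult_ac)

lemma linear_\<theta>: "linear (\<theta> x)"
  by (rule linearI) (simp_all add: \<theta>_def DF_simps ambient_form_simps)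

lemma linear_A: "linear (A x)"
proof (rule linearI)
  show "A x (u + v) = A x u + A x v" for u v
    by (rule injD[OF inj_DF])
       (simp add: DF_simps DF_A DN_simps linear_add[OF linear_\<theta>] algebra_simps)
  show "A x (r *\<^sub>R u) = r *\<^sub>R A x u" for r u
    by (rule injD[OF inj_DF])
       (simp add: DF_simps DF_A DN_simps linear_scale[OF linear_\<theta>] algebra_simps)
qed

lemma h_eq: "h x v w = G x (A x v) w"
  using P_orthogonal[of w] by (simp add: h_def G_def DF_A ambient_form_simps ambient_form_commute[of c "P x"])

text \<open>Differentiating \<open>B (N y) (DF y w) = 0\<close> expresses \<open>h\<close> through
  the second derivative of \<open>F\<close>, which is symmetric.\<close>

lemma h_commute: "h x v w = h x w v"
proof -
  have "B (N x) (D2F x v w) + B (DN x v) (DF x w) = 0" for v w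
    by (rule derivative_unique_on_open[OF open_\<Omega> x _
          has_derivative_ambient_form[OF N_derivative DF_derivative] has_derivative_const[of 0]])
       (simp add: N_normal)
  then have "h x v w = B (N x) (D2F x v w)" for v w
    unfolding h_def by (metis add_eq_0_iff2 minus_minus)
  then show ?thesis by (simp add: D2F_commute)
qed

lemma bilinear_G: "bilinear (G x)"
  unfolding bilinear_def
  by (auto intro!: linearI simp: G_def DF_simps ambient_form_simps)

lemma G_commute: "G x v w = G x w v"
  by (simp add: G_def ambient_form_commute)

lemma self_adjoint_A: "self_adjoint (G x) (A x)"
proof (rule self_adjoint.intro)
  show "0 < G x u u" if "u \<noteq> 0" for u
    using metric_pos[OF x that] by (simp add: G_def)
  show "G x (A x u) v = G x u (A x v)" for u v
    using h_eq[of u v] h_eq[of v u] h_commute[of u v] by (simp add: G_commute)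
qed (fact bilinear_G G_commute linear_A)+

interpretation self_adjoint "G x" "A x"
  by (rule self_adjoint_A)

lemma \<theta>_eq: "\<theta> x u = G x (T x) u"
proof -
  have "\<theta> x u = B (DF x u) (DF x (T x) + \<nu> x *\<^sub>R N x)"
    unfolding \<theta>_def by (rule arg_cong[OF decomposition[OF x]])
  then show ?thesis
    using N_normal[OF x, of u]
    by (simp add: ambient_form_simps G_def ambient_form_commute[of c "DF x u"])
qed

text \<open>Derivative of \<open>P_orthogonal\<close>. Up to sign, the right-hand side is the
  pullback of the metric of the factor \<open>Q\<^sub>c\<close> alone.\<close>

lemma D2F_P: "B (D2F x w u) (P x) = - (G x u w - \<theta> x u * \<theta> x w)"
proof -
  have "B (DF x u) (position_normal (DF x w)) + B (D2F x w u) (P x) = 0"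
    by (rule derivative_unique_on_open[OF open_\<Omega> x _
          has_derivative_ambient_form[OF DF_derivative P_derivative] has_derivative_const[of 0]])
       (use local_hypersurface.P_orthogonal[OF local_hypersurface_axioms] in simp)
  then show ?thesis
    by (simp add: ambient_form_position_normal G_def \<theta>_def)
qed

text \<open>In \<open>C\<close> the second derivatives of \<open>N\<close> and \<open>F\<close> and
  the cubic term in \<open>\<theta>\<close> are symmetric in \<open>u\<close> and \<open>v\<close>,
  so only the term with \<open>\<theta> x v * G x u w\<close> survives in the difference.\<close>

lemma Codazzi: "C x u v w - C x v u w = c * \<nu> x * (\<theta> x v * G x u w - \<theta> x u * G x v w)"
  by (simp add: C_def K_def D2F_commute[of u v] D2N_commute[of u v] algebra_simps)

lemma K_scale: "K x u v (r *\<^sub>R w) = r * K x u v w"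
  by (simp add: K_def DF_simps ambient_form_simps)

section \<open>Derivatives of tangent fields\<close>

lemma DF_field_derivative:
  assumes "(V has_derivative V') (at x)"
  shows "((\<lambda>y. DF y (V y)) has_derivative (\<lambda>u. D2F x u (V x) + DF x (V' u))) (at x)"
proof (rule has_derivative_linear_family_apply[OF _ DF_derivative assms])
  show "\<forall>\<^sub>F y in nhds x. linear (frechet_derivative F (at y))"
    using eventually_in_\<Omega> by eventually_elim (rule local_hypersurface.linear_DF[OF local_hypersurface_axioms])
qed

lemma DN_field_derivative:
  assumes "(V has_derivative V') (at x)"
  shows "((\<lambda>y. DN y (V y)) has_derivative (\<lambda>u. D2N x u (V x) + DN x (V' u))) (at x)"
proof (rule has_derivative_linear_family_apply[OF _ DN_derivative assms])
  show "\<forall>\<^sub>F y in nhds x. linear (frechet_derivative N (at y))"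
    using eventually_in_\<Omega> by eventually_elim (rule local_hypersurface.linear_DN[OF local_hypersurface_axioms])
qed

lemma differentiable_field_if_DF:
  assumes "\<And>y. y \<in> \<Omega> \<Longrightarrow> DF y (Z y) = w y" and "w differentiable (at x)"
  shows "Z differentiable (at x)"
proof (rule differentiable_linear_solution[where L = "\<lambda>y. frechet_derivative F (at y)", OF _ _ inj_DF _ assms(2)])
  show "\<forall>\<^sub>F y in nhds x. linear (frechet_derivative F (at y))"
    using eventually_in_\<Omega> by eventually_elim (rule local_hypersurface.linear_DF[OF local_hypersurface_axioms])
  show "\<forall>\<^sub>F y in nhds x. DF y (Z y) = w y"
    using eventually_in_\<Omega> by eventually_elim (rule assms(1))
  show "(\<lambda>y. DF y v) differentiable (at x)" for v
    using DF_derivative[of v] by (auto simp: differentiable_def)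
qed

lemma \<nu>_derivative: "(\<nu> has_derivative (\<lambda>u. B (DN x u) partial_t)) (at x)"
proof -
  have "((\<lambda>y. B (N y) partial_t) has_derivative (\<lambda>u. B (DN x u) partial_t)) (at x)"
    using has_derivative_ambient_form[OF N_derivative has_derivative_const[of partial_t]]
    by (simp add: ambient_form_simps)
  then show ?thesis
    by (rule has_derivative_transform_within_open[OF _ open_\<Omega> x])
       (rule local_hypersurface.N_partial_t[OF local_hypersurface_axioms])
qed

lemma differentiable_T: "T differentiable (at x)"
proof (rule differentiable_field_if_DF)
  show "DF y (T y) = partial_t - \<nu> y *\<^sub>R N y" if "y \<in> \<Omega>" for y
    using decomposition[OF that] by (simp add: algebra_simps)
  show "(\<lambda>y. partial_t - \<nu> y *\<^sub>R N y) differentiable (at x)"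
    using \<nu>_derivative N_derivative
    by (intro differentiable_diff differentiable_scaleR differentiable_const)
       (auto simp: differentiable_def)
qed

text \<open>The image under \<open>DF\<close> is given by \<open>DF_A\<close>, whose right-hand side
  is differentiable along \<open>V\<close>. Iterated, this makes polynomials in \<open>A\<close>
  applied to a fixed vector differentiable.\<close>

lemma differentiable_A_field:
  assumes "V differentiable (at x)"
  shows "(\<lambda>y. A y (V y)) differentiable (at x)"
proof (rule differentiable_field_if_DF)
  show "DF y (A y (V y)) = - DN y (V y) + (c * \<nu> y * B (DF y (V y)) partial_t) *\<^sub>R P y" if "y \<in> \<Omega>" for y
    using local_hypersurface.DF_A[OF local_hypersurface_axioms that] local_hypersurface.\<theta>_def[OF local_hypersurface_axioms]
    by simp
  obtain V' where V': "(V has_derivative V') (at x)"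
    using assms by (auto simp: differentiable_def)
  have "(\<lambda>y. DN y (V y)) differentiable (at x)" "\<nu> differentiable (at x)" "P differentiable (at x)"
    "(\<lambda>y. B (DF y (V y)) partial_t) differentiable (at x)"
    using DN_field_derivative[OF V'] \<nu>_derivative P_derivative
      has_derivative_ambient_form[OF DF_field_derivative[OF V'] has_derivative_const[of partial_t]]
    unfolding differentiable_def by blast+
  then show "(\<lambda>y. - DN y (V y) + (c * \<nu> y * B (DF y (V y)) partial_t) *\<^sub>R P y) differentiable (at x)"
    by (intro differentiable_add differentiable_minus differentiable_scaleR differentiable_mult
        differentiable_const)
qed

text \<open>The tangential part of the derivative of the constant field \<open>partial_t\<close>.
  The left-hand side is the pairing of the covariant derivative of \<open>T\<close> along
  \<open>u\<close> with \<open>w\<close>, so this says that the covariant derivative is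
  \<open>\<nu> A u\<close>.\<close>

lemma T_derivative:
  assumes T': "(T has_derivative T') (at x)"
  shows "K x u (T x) w + G x (T' u) w = \<nu> x * h x u w"
proof -
  have "D2F x u (T x) + DF x (T' u) = 0 - (\<nu> x *\<^sub>R DN x u + B (DN x u) partial_t *\<^sub>R N x)"
    by (rule derivative_unique_on_open[OF open_\<Omega> x _ DF_field_derivative[OF T']
          has_derivative_diff[OF has_derivative_const has_derivative_scaleR[OF \<nu>_derivative N_derivative]]])
       (simp add: eq_diff_eq decomposition[symmetric])
  then have "B (D2F x u (T x) + DF x (T' u)) (DF x w)
      = B (0 - (\<nu> x *\<^sub>R DN x u + B (DN x u) partial_t *\<^sub>R N x)) (DF x w)"
    by simp
  then show ?thesis
    by (simp add: ambient_form_simps K_def G_def h_def N_normal[OF x])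
qed

text \<open>The right-hand side pairs \<open>l - A\<close>, applied to the covariant derivative of
  \<open>V\<close> along \<open>u\<close>, with \<open>w\<close>. It results from differentiating
  \<open>h y (V y) w = l * G y (V y) w\<close>, written with \<open>DN\<close> and \<open>DF\<close>
  so that \<open>A\<close> itself is never differentiated.\<close>

lemma C_eigenfield:
  assumes V: "(V has_derivative V') (at x)"
    and eigen: "\<And>y. y \<in> \<Omega> \<Longrightarrow> A y (V y) = l *\<^sub>R V y"
  shows "C x u (V x) w = l * K x u (V x) w - K x u (V x) (A x w) + l * G x (V' u) w - h x (V' u) w"
proof -
  have "- (B (DN x (V x)) (D2F x u w) + B (D2N x u (V x) + DN x (V' u)) (DF x w))
      = l * (B (DF x (V x)) (D2F x u w) + B (D2F x u (V x) + DF x (V' u)) (DF x w))"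
  proof (rule derivative_unique_on_open[OF open_\<Omega> x _
          has_derivative_minus[OF has_derivative_ambient_form[OF DN_field_derivative[OF V] DF_derivative]]
          has_derivative_mult_right[OF has_derivative_ambient_form[OF DF_field_derivative[OF V] DF_derivative]]])
    fix y assume "y \<in> \<Omega>"
    then show "- B (DN y (V y)) (DF y w) = l * B (DF y (V y)) (DF y w)"
      using local_hypersurface.h_eq[OF local_hypersurface_axioms, of y "V y" w] eigen[of y]
        bilinear_lmul[OF local_hypersurface.bilinear_G[OF local_hypersurface_axioms], of y l "V y" w]
      by (simp add: local_hypersurface.h_def[OF local_hypersurface_axioms] local_hypersurface.G_def[OF local_hypersurface_axioms])
  qed
  \<comment> \<open>The part of \<open>DN x (V x)\<close> along \<open>P x\<close> meets the second
    derivative of \<open>F\<close> through \<open>D2F_P\<close> and reproduces the last term in the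
    definition of \<open>C\<close>.\<close>
  moreover have "B (DN x (V x)) (D2F x u w)
      = - l * K x u w (V x) - c * \<nu> x * \<theta> x (V x) * (G x w u - \<theta> x w * \<theta> x u)"
  proof -
    have "DN x (V x) = (c * \<nu> x * \<theta> x (V x)) *\<^sub>R P x - l *\<^sub>R DF x (V x)"
      using DF_A[of "V x"] eigen[OF x] by (simp add: DF_simps algebra_simps)
    then show ?thesis
      using D2F_P[of w u]
      by (simp add: ambient_form_simps K_def ambient_form_commute[of c "P x"]
          ambient_form_commute[of c "DF x (V x)"] right_diff_distrib)
  qed
  moreover have "B (DF x (V x)) (D2F x u w) = K x u w (V x)"
    by (simp add: K_def ambient_form_commute)
  ultimately show ?thesis
    by (simp add: C_def ambient_form_simps h_def G_commute[of u w])
       (simp add: G_def K_def algebra_simps)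
qed

end

section \<open>Constant principal curvatures\<close>

text \<open>\<open>\<mu>\<close> stands for the simple principal curvature; constancy is expressed
  by \<open>\<Lambda>\<close> being the same at all points.\<close>

context
  fixes \<Lambda> :: "real set" and \<mu> :: real
  assumes finite_\<Lambda>: "finite \<Lambda>"
    and eigenvalue_in_\<Lambda>: "x \<in> \<Omega> \<Longrightarrow> A x v = l *\<^sub>R v \<Longrightarrow> v \<noteq> 0 \<Longrightarrow> l \<in> \<Lambda>"
    and dim_eigenspace: "x \<in> \<Omega> \<Longrightarrow> l \<in> \<Lambda> \<Longrightarrow> l \<noteq> \<mu> \<Longrightarrow> 2 \<le> dim {v. A x v = l *\<^sub>R v}"
begin

text \<open>The polynomial whose roots are the other elements of \<open>\<Lambda>\<close> is applied
  to the constant field \<open>v\<close>. Because the eigenvalues are constant, the same polynomial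
  maps into the \<open>l\<close>-eigenspace at every point.\<close>

lemma eigenfield_extension:
  assumes x: "x \<in> \<Omega>" and v: "A x v = l *\<^sub>R v"
  obtains V where "V differentiable (at x)" "V x = v" "\<And>y. y \<in> \<Omega> \<Longrightarrow> A y (V y) = l *\<^sub>R V y"
proof -
  obtain ks where ks: "set ks = \<Lambda> - {l}"
    using finite_\<Lambda> finite_list[of "\<Lambda> - {l}"] by blast
  define W where "W y = foldr (\<lambda>k z. A y z - k *\<^sub>R z) ks v" for y
  have "(\<lambda>y. foldr (\<lambda>k z. A y z - k *\<^sub>R z) js v) differentiable (at x)" for js
    by (induction js)
       (simp_all add: differentiable_diff differentiable_scaleR differentiable_A_field[OF x])
  then have W: "W differentiable (at x)" by (simp add: W_def[abs_def])
  have W_eigen: "A y (W y) = l *\<^sub>R W y" if "y \<in> \<Omega>" for y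
    unfolding W_def
    by (rule self_adjoint.product_of_shifts_in_eigenspace[OF self_adjoint_A[OF that]])
       (use ks eigenvalue_in_\<Lambda>[OF that] in blast)
  \<comment> \<open>At \<open>x\<close> the field is this multiple of \<open>v\<close>; as
    \<open>l\<close> is not a root, it can be normalised.\<close>
  define r where "r = (\<Prod>k\<leftarrow>ks. l - k)"
  have "l \<notin> set ks" using ks by blast
  then have "r \<noteq> 0" unfolding r_def by (induction ks) auto
  have Wx: "W x = r *\<^sub>R v"
    unfolding W_def r_def
    by (rule self_adjoint.product_of_shifts_eigenvector[OF self_adjoint_A[OF x] v])
  show ?thesis
  proof
    show "(\<lambda>y. (1 / r) *\<^sub>R W y) differentiable (at x)"
      using W by (intro differentiable_scaleR differentiable_const)
    show "(1 / r) *\<^sub>R W x = v" using Wx \<open>r \<noteq> 0\<close> by simp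
    show "A y ((1 / r) *\<^sub>R W y) = l *\<^sub>R (1 / r) *\<^sub>R W y" if "y \<in> \<Omega>" for y
      using W_eigen[OF that] by (simp add: linear_scale[OF linear_A[OF that]])
  qed
qed

text \<open>After extending \<open>v\<close> to an eigenfield, self-adjointness moves
  \<open>l - A\<close> onto \<open>w\<close>, where it vanishes.\<close>

lemma C_eigenspace:
  assumes x: "x \<in> \<Omega>" and v: "A x v = l *\<^sub>R v" and w: "A x w = l *\<^sub>R w"
  shows "C x u v w = 0"
proof -
  obtain V where V: "V differentiable (at x)" "V x = v" "\<And>y. y \<in> \<Omega> \<Longrightarrow> A y (V y) = l *\<^sub>R V y"
    using eigenfield_extension[OF x v] by blast
  obtain V' where V': "(V has_derivative V') (at x)"
    using V(1) by (auto simp: differentiable_def)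
  have "h x (V' u) w = l * G x (V' u) w"
    using h_eq[OF x, of w "V' u"] h_commute[OF x] G_commute[OF x] w
    by (simp add: bilinear_lmul[OF bilinear_G[OF x]] bilinear_rmul[OF bilinear_G[OF x]])
  then show ?thesis
    using C_eigenfield[OF x V' V(3), of u w] V(2) w by (simp add: K_scale[OF x])
qed

lemma \<theta>_multiple_eigenspace:
  assumes x: "x \<in> \<Omega>" and l: "l \<in> \<Lambda>" "l \<noteq> \<mu>" and v: "A x v = l *\<^sub>R v"
  shows "\<theta> x v = 0"
proof (rule ccontr)
  assume nz: "\<theta> x v \<noteq> 0"
  have "\<not> {v. A x v = l *\<^sub>R v} \<subseteq> span {v}"
  proof
    assume "{v. A x v = l *\<^sub>R v} \<subseteq> span {v}"
    then have "dim {v. A x v = l *\<^sub>R v} \<le> card {v}"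
      by (intro dim_le_card) auto
    then show False using dim_eigenspace[OF x l] by simp
  qed
  then obtain u where u: "A x u = l *\<^sub>R u" "u \<notin> span {v}" by blast
  \<comment> \<open>This combination stays in the eigenspace, and pairing the Codazzi equation with
    it turns the right-hand side into a nonzero multiple of \<open>G x z z\<close>. So
    \<open>z = 0\<close>, against the independence of \<open>u\<close> and \<open>v\<close>.\<close>
  define z where "z = \<theta> x v *\<^sub>R u - \<theta> x u *\<^sub>R v"
  have z: "A x z = l *\<^sub>R z"
    using u(1) v by (simp add: z_def linear_diff[OF linear_A[OF x]] linear_scale[OF linear_A[OF x]]
        algebra_simps)
  have "c * \<nu> x * (\<theta> x v * G x u z - \<theta> x u * G x v z) = 0"
    using Codazzi[OF x, of u v z] C_eigenspace[OF x v z] C_eigenspace[OF x u(1) z] by simp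
  then have "\<theta> x v * G x u z - \<theta> x u * G x v z = 0"
    using c_nonzero \<nu>_nonzero[OF x] by simp
  moreover have "G x z z = \<theta> x v * G x u z - \<theta> x u * G x v z"
    by (subst (1) z_def)
       (simp add: bilinear_lsub[OF bilinear_G[OF x]] bilinear_lmul[OF bilinear_G[OF x]])
  ultimately have "G x z z = 0" by simp
  then have "z = 0"
    using self_adjoint.eq_0_iff[OF self_adjoint_A[OF x]] by blast
  then have "(1 / \<theta> x v) *\<^sub>R \<theta> x v *\<^sub>R u = (1 / \<theta> x v) *\<^sub>R \<theta> x u *\<^sub>R v"
    by (simp add: z_def)
  then have "u = (\<theta> x u / \<theta> x v) *\<^sub>R v"
    using nz by simp
  then have "u \<in> span {v}"
    by (metis span_base span_scale singletonI)
  then show False using u(2) by simp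
qed

text \<open>\<open>\<theta>\<close> kills every eigenspace except that of \<open>\<mu>\<close>, so
  the difference of the two sides is orthogonal to all eigenvectors. The case \<open>T x = 0\<close>
  is still allowed here.\<close>

lemma T_eigenvector:
  assumes x: "x \<in> \<Omega>"
  shows "A x (T x) = \<mu> *\<^sub>R T x"
proof -
  interpret self_adjoint "G x" "A x" by (rule self_adjoint_A[OF x])
  have "G x (A x (T x) - \<mu> *\<^sub>R T x) e = 0" if e: "A x e = k *\<^sub>R e" for k e
  proof -
    have "G x (A x (T x) - \<mu> *\<^sub>R T x) e = (k - \<mu>) * G x (T x) e"
      by (simp add: bilinear_rules self_adjoint e algebra_simps)
    also have "\<dots> = 0"
    proof (cases "e = 0 \<or> k = \<mu>")
      case False
      then have "\<theta> x e = 0"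
        using \<theta>_multiple_eigenspace[OF x _ _ e] eigenvalue_in_\<Lambda>[OF x e] by blast
      then show ?thesis by (simp add: \<theta>_eq[OF x])
    qed (auto simp: bilinear_rules)
    finally show ?thesis .
  qed
  then have "A x (T x) - \<mu> *\<^sub>R T x = 0" by (rule orthogonal_to_eigenvectors_imp_0)
  then show ?thesis by simp
qed

lemma eigenvalue_identity:
  assumes x: "x \<in> \<Omega>" and l: "l \<in> \<Lambda>" "l \<noteq> \<mu>"
  shows "l * (\<mu> - l) = c * G x (T x) (T x)"
proof -
  interpret self_adjoint "G x" "A x" by (rule self_adjoint_A[OF x])
  have "{v. A x v = l *\<^sub>R v} \<noteq> {0}"
    using dim_eigenspace[OF x l] by (metis dim_singleton not_numeral_le_zero)
  moreover have "A x 0 = l *\<^sub>R 0" using linear_0[OF linear] by simp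
  ultimately obtain v where v: "A x v = l *\<^sub>R v" "v \<noteq> 0" by blast
  obtain T' where T': "(T has_derivative T') (at x)"
    using differentiable_T[OF x] by (auto simp: differentiable_def)
  have Gv: "G x v v > 0" using pos[OF v(2)] .
  have \<theta>v: "\<theta> x v = 0" by (rule \<theta>_multiple_eigenspace[OF x l v(1)])
  have Tv: "C x (T x) v v = 0" by (rule C_eigenspace[OF x v(1) v(1)])
  have hv: "h x z v = l * G x z v" for z
    by (simp add: h_eq[OF x] self_adjoint v(1) bilinear_rules)
  \<comment> \<open>By \<open>T_eigenvector\<close>, \<open>T\<close> is itself a differentiable
    eigenfield for \<open>\<mu>\<close>, so it can serve as the field in
    \<open>C_eigenfield\<close>.\<close>
  have "C x v (T x) v = (\<mu> - l) * (K x v (T x) v + G x (T' v) v)"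
    using C_eigenfield[OF x T' T_eigenvector, of v v] v(1)
    by (simp add: K_scale[OF x] hv algebra_simps)
  also have "\<dots> = (\<mu> - l) * (\<nu> x * (l * G x v v))"
    by (simp add: T_derivative[OF x T'] hv)
  finally have "(\<mu> - l) * (\<nu> x * (l * G x v v)) = c * \<nu> x * (\<theta> x (T x) * G x v v)"
    using Codazzi[OF x, of v "T x" v] Tv \<theta>v by simp
  then have "(\<nu> x * G x v v) * (l * (\<mu> - l)) = (\<nu> x * G x v v) * (c * \<theta> x (T x))"
    by (simp add: mult_ac)
  then show ?thesis
    using Gv \<nu>_nonzero[OF x] by (simp add: \<theta>_eq[OF x])
qed

lemma multiple_eigenvalue_nonzero:
  assumes x: "x \<in> \<Omega>" and l: "l \<in> \<Lambda>" "l \<noteq> \<mu>" and w: "A x w = \<mu> *\<^sub>R w" "w \<noteq> 0"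
  shows "l \<noteq> 0"
proof
  assume "l = 0"
  interpret self_adjoint "G x" "A x" by (rule self_adjoint_A[OF x])
  \<comment> \<open>The vanishing is needed on all of \<open>\<Omega>\<close>, not just at
    \<open>x\<close>, because \<open>T\<close> is differentiated next.\<close>
  have T0: "T y = 0" if "y \<in> \<Omega>" for y
    using eigenvalue_identity[OF that l] c_nonzero \<open>l = 0\<close>
      self_adjoint.eq_0_iff[OF self_adjoint_A[OF that]] by simp
  have T': "(T has_derivative (\<lambda>_. 0)) (at x)"
    by (rule has_derivative_transform_within_open[OF has_derivative_const[of 0] open_\<Omega> x])
       (simp add: T0)
  \<comment> \<open>With \<open>T x = 0\<close>, the term \<open>K x w (T x) w\<close> contains this
    second derivative, which vanishes since \<open>DF y 0 = 0\<close> throughout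
    \<open>\<Omega>\<close>.\<close>
  have "D2F x w 0 = 0"
    by (rule derivative_unique_on_open[OF open_\<Omega> x _ DF_derivative[OF x] has_derivative_const[of 0]])
       (simp add: DF_simps)
  then have "K x w (T x) w = 0"
    by (simp add: K_def T0[OF x] ambient_form_simps)
  then have "\<nu> x * (\<mu> * G x w w) = 0"
    using T_derivative[OF x T', of w w] w(1) by (simp add: h_eq[OF x] bilinear_rules)
  then show False
    using \<nu>_nonzero[OF x] l(2) \<open>l = 0\<close> pos[OF w(2)] by simp
qed

lemma T_nonzero:
  assumes x: "x \<in> \<Omega>" and l: "l \<in> \<Lambda>" "l \<noteq> \<mu>" and w: "A x w = \<mu> *\<^sub>R w" "w \<noteq> 0"
  shows "T x \<noteq> 0"
proof
  assume "T x = 0"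
  then have "l * (\<mu> - l) = 0"
    using eigenvalue_identity[OF x l] by (simp add: bilinear_lzero[OF bilinear_G[OF x]])
  then show False using l(2) multiple_eigenvalue_nonzero[OF x l w] by simp
qed

end

end

section \<open>Passage to charts\<close>

locale smooth_atlas_space =
  fixes X :: "'m topology" and \<A> :: "('m, 'n::finite) chart set"
  assumes atlas: "smooth_atlas X \<A>"
begin

lemma chart_at:
  assumes "p \<in> topspace X"
  shows "chart_at \<A> p \<in> \<A>" "p \<in> fst (chart_at \<A> p)"
proof -
  have "\<exists>\<kappa>. \<kappa> \<in> \<A> \<and> p \<in> fst \<kappa>"
    using assms atlas unfolding smooth_atlas_def case_prod_unfold by blast
  then have "chart_at \<A> p \<in> \<A> \<and> p \<in> fst (chart_at \<A> p)"
    unfolding chart_at_def by (rule someI_ex)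
  then show "chart_at \<A> p \<in> \<A>" "p \<in> fst (chart_at \<A> p)" by auto
qed

lemma chart:
  assumes "\<kappa> \<in> \<A>"
  shows "openin X (fst \<kappa>)" "open (snd \<kappa> ` fst \<kappa>)"
    "homeomorphic_map (subtopology X (fst \<kappa>)) (top_of_set (snd \<kappa> ` fst \<kappa>)) (snd \<kappa>)"
  using assms atlas unfolding smooth_atlas_def case_prod_unfold by blast+

lemma smooth_transition:
  assumes "\<kappa> \<in> \<A>" "\<delta> \<in> \<A>"
  shows "smooth_on (snd \<delta> \<circ> chart_inv \<kappa>) (snd \<kappa> ` (fst \<kappa> \<inter> fst \<delta>))"
  using assms atlas unfolding smooth_atlas_def case_prod_unfold prod.collapse by blast

lemma smooth_map_chart:
  assumes "smooth_map \<A> h" "\<kappa> \<in> \<A>"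
  shows "smooth_on (h \<circ> chart_inv \<kappa>) (snd \<kappa> ` fst \<kappa>)"
  using assms unfolding smooth_map_def case_prod_unfold prod.collapse by blast

lemma chart_subset: "\<kappa> \<in> \<A> \<Longrightarrow> fst \<kappa> \<subseteq> topspace X"
  using chart(1) openin_subset by blast

lemma chart_inj:
  assumes "\<kappa> \<in> \<A>"
  shows "inj_on (snd \<kappa>) (fst \<kappa>)"
proof -
  have "topspace (subtopology X (fst \<kappa>)) = fst \<kappa>"
    using chart_subset[OF assms] by auto
  then show ?thesis
    using homeomorphic_imp_injective_map[OF chart(3)[OF assms]] by simp
qed

lemma chart_inv_chart:
  "\<kappa> \<in> \<A> \<Longrightarrow> p \<in> fst \<kappa> \<Longrightarrow> chart_inv \<kappa> (snd \<kappa> p) = p"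
  unfolding chart_inv_def by (simp add: chart_inj)

lemma open_chart_image:
  assumes "\<kappa> \<in> \<A>" "\<delta> \<in> \<A>"
  shows "open (snd \<kappa> ` (fst \<kappa> \<inter> fst \<delta>))"
proof -
  have "openin (subtopology X (fst \<kappa>)) (fst \<kappa> \<inter> fst \<delta>)"
    using chart(1)[OF assms(2)] by (auto simp: openin_subtopology)
  then have "openin (top_of_set (snd \<kappa> ` fst \<kappa>)) (snd \<kappa> ` (fst \<kappa> \<inter> fst \<delta>))"
    using homeomorphic_imp_open_map[OF chart(3)[OF assms(1)]] by (simp add: open_map_def)
  then show ?thesis
    using chart(2)[OF assms(1)] openin_open_trans by blast
qed

text \<open>Tangent vectors at \<open>q\<close> are read in \<open>chart_at \<A> q\<close>; this map
  converts them to coordinates in \<open>\<kappa>\<close>. As the reference chart is chosen point by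
  point, the map need not be continuous in \<open>q\<close>, so derivatives are taken in the fixed
  chart \<open>\<kappa>\<close>.\<close>

definition coord_change :: "('m, 'n) chart \<Rightarrow> 'm \<Rightarrow> real ^ 'n \<Rightarrow> real ^ 'n" where
  "coord_change \<kappa> q = frechet_derivative (snd \<kappa> \<circ> chart_inv (chart_at \<A> q)) (at (snd (chart_at \<A> q) q))"

context
  fixes \<kappa> :: "('m, 'n) chart" and q :: 'm
  assumes \<kappa>: "\<kappa> \<in> \<A>" and q: "q \<in> fst \<kappa>"
begin

lemma point_in_topspace: "q \<in> topspace X"
  using \<kappa> q chart_subset by blast

lemma point_in_overlap: "snd (chart_at \<A> q) q \<in> snd (chart_at \<A> q) ` (fst (chart_at \<A> q) \<inter> fst \<kappa>)"
  using q chart_at(2)[OF point_in_topspace] by blast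

lemma transition_derivative:
  "((snd \<kappa> \<circ> chart_inv (chart_at \<A> q)) has_derivative coord_change \<kappa> q) (at (snd (chart_at \<A> q) q))"
  unfolding coord_change_def
  by (rule smooth_on_has_derivative[OF smooth_transition[OF chart_at(1)[OF point_in_topspace] \<kappa>]
        point_in_overlap])

lemma linear_coord_change: "linear (coord_change \<kappa> q)"
  using transition_derivative has_derivative_linear by blast

lemma differential_at_eq:
  fixes h :: "'m \<Rightarrow> 'e::real_normed_vector"
  assumes h: "smooth_map \<A> h"
  shows "differential_at \<A> h q u =
    frechet_derivative (h \<circ> chart_inv \<kappa>) (at (snd \<kappa> q)) (coord_change \<kappa> q u)"
proof -
  let ?\<delta> = "chart_at \<A> q"
  let ?D = "frechet_derivative (h \<circ> chart_inv \<kappa>) (at (snd \<kappa> q))"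
  have \<delta>: "?\<delta> \<in> \<A>" "q \<in> fst ?\<delta>" by (rule chart_at[OF point_in_topspace])+
  have "((h \<circ> chart_inv \<kappa>) has_derivative ?D) (at ((snd \<kappa> \<circ> chart_inv ?\<delta>) (snd ?\<delta> q)))"
    using smooth_on_has_derivative[OF smooth_map_chart[OF h \<kappa>], of "snd \<kappa> q"] q
    by (simp add: chart_inv_chart[OF \<delta>])
  then have "((h \<circ> chart_inv \<kappa> \<circ> (snd \<kappa> \<circ> chart_inv ?\<delta>)) has_derivative (?D \<circ> coord_change \<kappa> q))
      (at (snd ?\<delta> q))"
    by (rule diff_chain_at[OF transition_derivative])
  \<comment> \<open>The two compositions agree on the image of the chart overlap, which is an open
    neighbourhood of the point.\<close>
  then have "((h \<circ> chart_inv ?\<delta>) has_derivative (?D \<circ> coord_change \<kappa> q)) (at (snd ?\<delta> q))"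
    by (rule has_derivative_transform_within_open[OF _ open_chart_image[OF \<delta>(1) \<kappa>] point_in_overlap])
       (auto simp: chart_inv_chart[OF \<delta>(1)] chart_inv_chart[OF \<kappa>])
  from frechet_derivative_at[OF this] show ?thesis
    unfolding differential_at_def by (metis comp_apply)
qed

text \<open>The injective differential of \<open>h\<close> factors through
  \<open>coord_change\<close>, which is therefore injective, and bijective because both sides have
  equal dimension.\<close>

lemma bij_coord_change:
  fixes h :: "'m \<Rightarrow> 'e::real_normed_vector"
  assumes "smooth_map \<A> h" "inj (differential_at \<A> h q)"
  shows "bij (coord_change \<kappa> q)"
proof -
  have "inj (coord_change \<kappa> q)"
    using assms differential_at_eq[OF assms(1)] by (metis inj_def)
  then show ?thesis
    using linear_injective_imp_surjective[OF linear_coord_change] by (simp add: bij_def)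
qed

end

end

locale hypersurface = smooth_atlas_space X \<A>
  for X :: "'m topology" and \<A> :: "('m, 'n::finite) chart set" +
  fixes c :: real and g :: "'m \<Rightarrow> real ^ 'n \<Rightarrow> real ^ 'n \<Rightarrow> real" and f \<eta> :: "'m \<Rightarrow> 'n ambient"
    and A :: "'m \<Rightarrow> real ^ 'n \<Rightarrow> real ^ 'n" and T :: "'m \<Rightarrow> real ^ 'n" and \<nu> :: "'m \<Rightarrow> real"
  assumes c: "c \<noteq> 0"
    and metric: "riemannian_metric X \<A> g"
    and immersion: "isometric_immersion c X \<A> g f"
    and normal: "unit_normal_field c X \<A> f \<eta>"
    and shape: "is_shape_operator c X \<A> f \<eta> A"
    and decomp: "partial_t_decomposition X \<A> f \<eta> T \<nu>"
    and nonzero: "\<forall>p\<in>topspace X. \<nu> p \<noteq> 0"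
begin

context
  fixes \<kappa> assumes \<kappa>: "\<kappa> \<in> \<A>"
begin

text \<open>Conjugation by \<open>coord_change\<close> preserves eigenvalues and the dimensions of
  eigenspaces.\<close>

definition "coord_shape x =
  coord_change \<kappa> (chart_inv \<kappa> x) \<circ> A (chart_inv \<kappa> x) \<circ> inv (coord_change \<kappa> (chart_inv \<kappa> x))"

definition "coord_T x = coord_change \<kappa> (chart_inv \<kappa> x) (T (chart_inv \<kappa> x))"

lemma bij_coords: "q \<in> fst \<kappa> \<Longrightarrow> bij (coord_change \<kappa> q)"
  using bij_coord_change[OF \<kappa>, of q f] immersion point_in_topspace[OF \<kappa>, of q]
  by (simp add: isometric_immersion_def)

lemma coord_shape_eq:
  "q \<in> fst \<kappa> \<Longrightarrow> coord_shape (snd \<kappa> q) (coord_change \<kappa> q u) = coord_change \<kappa> q (A q u)"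
  using bij_coords[of q] by (simp add: coord_shape_def chart_inv_chart[OF \<kappa>] bij_is_inj)

lemma coord_shape_eigenvector_iff:
  assumes "q \<in> fst \<kappa>"
  shows "coord_shape (snd \<kappa> q) (coord_change \<kappa> q u) = l *\<^sub>R coord_change \<kappa> q u \<longleftrightarrow> A q u = l *\<^sub>R u"
proof -
  have "l *\<^sub>R coord_change \<kappa> q u = coord_change \<kappa> q (l *\<^sub>R u)"
    using linear_scale[OF linear_coord_change[OF \<kappa> assms]] by simp
  then show ?thesis
    using bij_coords[OF assms] by (simp add: coord_shape_eq[OF assms] bij_is_inj inj_eq)
qed

lemma coord_change_eq_0_iff:
  assumes "q \<in> fst \<kappa>"
  shows "coord_change \<kappa> q u = 0 \<longleftrightarrow> u = 0"
  using bij_is_inj[OF bij_coords[OF assms]] linear_coord_change[OF \<kappa> assms]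
  by (metis linear_injective_0 linear_0)

lemma coord_shape_eigenvalue_iff:
  assumes "q \<in> fst \<kappa>"
  shows "(\<exists>v. v \<noteq> 0 \<and> coord_shape (snd \<kappa> q) v = l *\<^sub>R v) \<longleftrightarrow> l \<in> principal_curvatures_at A q"
proof -
  have "(\<exists>v. v \<noteq> 0 \<and> coord_shape (snd \<kappa> q) v = l *\<^sub>R v) \<longleftrightarrow>
      (\<exists>u. coord_change \<kappa> q u \<noteq> 0 \<and>
        coord_shape (snd \<kappa> q) (coord_change \<kappa> q u) = l *\<^sub>R coord_change \<kappa> q u)"
    using bij_is_surj[OF bij_coords[OF assms]] by (metis surjD)
  then show ?thesis
    by (simp add: principal_curvatures_at_def coord_shape_eigenvector_iff[OF assms]
        coord_change_eq_0_iff[OF assms])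
qed

lemma dim_coord_shape_eigenspace:
  assumes "q \<in> fst \<kappa>"
  shows "dim {v. coord_shape (snd \<kappa> q) v = l *\<^sub>R v} = multiplicity_at A q l"
proof -
  have "{v. coord_shape (snd \<kappa> q) v = l *\<^sub>R v} = coord_change \<kappa> q ` {u. A q u = l *\<^sub>R u}"
    using bij_is_surj[OF bij_coords[OF assms]] coord_shape_eigenvector_iff[OF assms]
    by (auto simp: image_iff) (metis surjD)
  then show ?thesis
    using dim_image_eq[OF linear_coord_change[OF \<kappa> assms]] bij_is_inj[OF bij_coords[OF assms]]
    by (simp add: multiplicity_at_def inj_on_subset)
qed

lemma local_hypersurface_chart:
  "local_hypersurface c (snd \<kappa> ` fst \<kappa>) (f \<circ> chart_inv \<kappa>) (\<eta> \<circ> chart_inv \<kappa>)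
     coord_shape coord_T (\<nu> \<circ> chart_inv \<kappa>)"
proof
  have f: "smooth_map \<A> f" and \<eta>: "smooth_map \<A> \<eta>"
    using immersion normal by (simp_all add: isometric_immersion_def unit_normal_field_def)
  show "c \<noteq> 0" by (rule c)
  show "open (snd \<kappa> ` fst \<kappa>)" by (rule chart(2)[OF \<kappa>])
  show "smooth_on (f \<circ> chart_inv \<kappa>) (snd \<kappa> ` fst \<kappa>)" by (rule smooth_map_chart[OF f \<kappa>])
  show "smooth_on (\<eta> \<circ> chart_inv \<kappa>) (snd \<kappa> ` fst \<kappa>)" by (rule smooth_map_chart[OF \<eta> \<kappa>])
  fix x assume "x \<in> snd \<kappa> ` fst \<kappa>"
  then obtain q where q: "q \<in> fst \<kappa>" and x: "x = snd \<kappa> q" by blast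
  have qX: "q \<in> topspace X" by (rule point_in_topspace[OF \<kappa> q])
  have inv: "chart_inv \<kappa> x = q" by (simp add: x chart_inv_chart[OF \<kappa> q])
  note df = differential_at_eq[OF \<kappa> q f, folded x] and d\<eta> = differential_at_eq[OF \<kappa> q \<eta>, folded x]
  show "(f \<circ> chart_inv \<kappa>) x \<in> product_space c"
    using immersion qX by (auto simp: isometric_immersion_def inv)
  show "ambient_form c ((\<eta> \<circ> chart_inv \<kappa>) x) (position_normal ((f \<circ> chart_inv \<kappa>) x)) = 0"
    "ambient_form c ((\<eta> \<circ> chart_inv \<kappa>) x) ((\<eta> \<circ> chart_inv \<kappa>) x) = 1"
    using normal qX by (auto simp: unit_normal_field_def product_tangent_space_def inv)
  show "(\<nu> \<circ> chart_inv \<kappa>) x \<noteq> 0"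
    using nonzero qX by (simp add: inv)
  have "partial_t = differential_at \<A> f q (T q) + \<nu> q *\<^sub>R \<eta> q"
    using decomp qX unfolding partial_t_decomposition_def by blast
  then show "partial_t = frechet_derivative (f \<circ> chart_inv \<kappa>) (at x) (coord_T x)
      + (\<nu> \<circ> chart_inv \<kappa>) x *\<^sub>R (\<eta> \<circ> chart_inv \<kappa>) x"
    unfolding coord_T_def inv comp_apply df .
  fix v
  obtain u where v: "v = coord_change \<kappa> q u"
    using bij_is_surj[OF bij_coords[OF q]] by (metis surjD)
  show "ambient_form c ((\<eta> \<circ> chart_inv \<kappa>) x) (frechet_derivative (f \<circ> chart_inv \<kappa>) (at x) v) = 0"
    using normal qX by (simp add: unit_normal_field_def v inv flip: df)
  have "differential_at \<A> f q (A q u) =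
      - product_tangent_proj c (f q) (differential_at \<A> \<eta> q u)"
    using shape qX by (simp add: is_shape_operator_def covariant_derivative_def)
  then show "frechet_derivative (f \<circ> chart_inv \<kappa>) (at x) (coord_shape x v) =
      - product_tangent_proj c ((f \<circ> chart_inv \<kappa>) x) (frechet_derivative (\<eta> \<circ> chart_inv \<kappa>) (at x) v)"
    using coord_shape_eq[OF q, of u, folded x] by (simp add: v inv df d\<eta>)
  \<comment> \<open>For negative \<open>c\<close> the ambient form is indefinite, so positivity on
    tangent vectors has to come from the Riemannian metric \<open>g\<close>.\<close>
  show "0 < ambient_form c (frechet_derivative (f \<circ> chart_inv \<kappa>) (at x) v)
      (frechet_derivative (f \<circ> chart_inv \<kappa>) (at x) v)" if "v \<noteq> 0"
  proof -
    have "u \<noteq> 0" using that coord_change_eq_0_iff[OF q] v by blast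
    then have "0 < g q u u"
      using metric qX by (simp add: riemannian_metric_def)
    then show ?thesis
      using immersion qX by (simp add: isometric_immersion_def v flip: df)
  qed
qed

end

end

theorem proposition7p4:
  fixes c :: real
    and X :: "'m topology"
    and \<A> :: "('m, 'n::finite) chart set"
    and g :: "'m \<Rightarrow> real ^ 'n \<Rightarrow> real ^ 'n \<Rightarrow> real"
    and f \<eta> :: "'m \<Rightarrow> 'n ambient"
    and A :: "'m \<Rightarrow> real ^ 'n \<Rightarrow> real ^ 'n"
    and T :: "'m \<Rightarrow> real ^ 'n"
    and \<nu> :: "'m \<Rightarrow> real"
    and \<Lambda> :: "real set"
    and m :: "real \<Rightarrow> nat"
  assumes "c \<in> {1, -1}"
    and "CARD('n) \<ge> 3"
    and "smooth_manifold X \<A>"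
    and "connected_space X"
    and "topspace X \<noteq> {}"
    and "riemannian_metric X \<A> g"
    and "isometric_immersion c X \<A> g f"
    and "unit_normal_field c X \<A> f \<eta>"
    and "is_shape_operator c X \<A> f \<eta> A"
    and "partial_t_decomposition X \<A> f \<eta> T \<nu>"
    and "\<forall>p\<in>topspace X. \<nu> p \<noteq> 0"
    and "constant_principal_curvatures X A \<Lambda> m"
    and "\<exists>!l. l \<in> \<Lambda> \<and> m l = 1"
  shows "(\<forall>l\<in>\<Lambda>. m l = 1 \<longrightarrow> principal_direction X A T l) \<and>
         (\<forall>l\<in>\<Lambda>. m l > 1 \<longrightarrow> l \<noteq> 0)"
proof -
  interpret hypersurface X \<A> c g f \<eta> A T \<nu>
    by unfold_locales (use assms in \<open>auto simp: smooth_manifold_def\<close>)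
  obtain \<mu> where \<mu>: "\<mu> \<in> \<Lambda>" "m \<mu> = 1" and uniq: "\<And>l. l \<in> \<Lambda> \<Longrightarrow> m l = 1 \<Longrightarrow> l = \<mu>"
    using assms(13) by blast
  have curvatures: "principal_curvatures_at A p = \<Lambda>" and
    mult: "\<And>l. l \<in> \<Lambda> \<Longrightarrow> multiplicity_at A p l = m l" if "p \<in> topspace X" for p
    using assms(12) that by (auto simp: constant_principal_curvatures_def)
  have pointwise: "A p (T p) = \<mu> *\<^sub>R T p \<and> T p \<noteq> 0 \<and> (\<forall>l\<in>\<Lambda>. l \<noteq> \<mu> \<longrightarrow> l \<noteq> 0)"
    if p: "p \<in> topspace X" for p
  proof -
    define \<kappa> where "\<kappa> = chart_at \<A> p"
    have \<kappa>: "\<kappa> \<in> \<A>" "p \<in> fst \<kappa>" unfolding \<kappa>_def by (rule chart_at[OF p])+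
    define x where "x = snd \<kappa> p"
    interpret L: local_hypersurface c "snd \<kappa> ` fst \<kappa>" "f \<circ> chart_inv \<kappa>" "\<eta> \<circ> chart_inv \<kappa>"
      "coord_shape \<kappa>" "coord_T \<kappa>" "\<nu> \<circ> chart_inv \<kappa>"
      by (rule local_hypersurface_chart[OF \<kappa>(1)])
    have x: "x \<in> snd \<kappa> ` fst \<kappa>" using \<kappa>(2) by (simp add: x_def)
    interpret S: self_adjoint "L.G x" "coord_shape \<kappa> x" by (rule L.self_adjoint_A[OF x])
    have eigen: "(\<exists>v. v \<noteq> 0 \<and> coord_shape \<kappa> y v = l *\<^sub>R v) \<longleftrightarrow> l \<in> \<Lambda>"
      if "y \<in> snd \<kappa> ` fst \<kappa>" for y l
      using that coord_shape_eigenvalue_iff[OF \<kappa>(1)] curvatures chart_subset[OF \<kappa>(1)] by blast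
    have dim: "dim {v. coord_shape \<kappa> y v = l *\<^sub>R v} = m l" if "y \<in> snd \<kappa> ` fst \<kappa>" "l \<in> \<Lambda>" for y l
      using that dim_coord_shape_eigenspace[OF \<kappa>(1)] mult chart_subset[OF \<kappa>(1)] by fastforce
    have finite: "finite \<Lambda>"
      using S.finite_eigenvalues by (simp add: eigen[OF x])
    have in_\<Lambda>: "l \<in> \<Lambda>" if "y \<in> snd \<kappa> ` fst \<kappa>" "coord_shape \<kappa> y v = l *\<^sub>R v" "v \<noteq> 0" for y l v
      using eigen[OF that(1)] that(2,3) by blast
    \<comment> \<open>The multiplicity is not 0 because \<open>l\<close> has an eigenvector, and not
      1 because \<open>\<mu>\<close> is the only simple curvature.\<close>
    have dim2: "2 \<le> dim {v. coord_shape \<kappa> y v = l *\<^sub>R v}"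
      if y: "y \<in> snd \<kappa> ` fst \<kappa>" and l: "l \<in> \<Lambda>" "l \<noteq> \<mu>" for y l
    proof -
      have "\<not> {v. coord_shape \<kappa> y v = l *\<^sub>R v} \<subseteq> {0}"
        using eigen[OF y] l(1) by blast
      then have "m l \<noteq> 0" using dim[OF y l(1)] by (metis dim_eq_0)
      moreover have "m l \<noteq> 1" using uniq l by blast
      ultimately show ?thesis using dim[OF y l(1)] by simp
    qed
    obtain w where w: "coord_shape \<kappa> x w = \<mu> *\<^sub>R w" "w \<noteq> 0"
      using eigen[OF x] \<mu>(1) by blast
    \<comment> \<open>A second curvature is required to conclude that \<open>T\<close> is nonzero.
      With \<open>\<mu>\<close> alone the shape operator would be a homothety, and the multiplicity
      of \<open>\<mu>\<close> would be \<open>CARD('n) \<ge> 3\<close> instead of 1.\<close>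
    obtain l where l: "l \<in> \<Lambda>" "l \<noteq> \<mu>"
    proof (rule ccontr)
      assume "\<not> thesis"
      then have "coord_shape \<kappa> x z = \<mu> *\<^sub>R z" for z
        using that in_\<Lambda>[OF x] by (intro S.single_eigenvalue_imp_homothety) blast
      then have "dim (UNIV :: (real ^ 'n) set) = 1"
        using dim[OF x \<mu>(1)] \<mu>(2) by simp
      then show False using assms(2) by simp
    qed
    have Tx: "coord_T \<kappa> x = coord_change \<kappa> p (T p)"
      by (simp add: coord_T_def[OF \<kappa>(1)] x_def chart_inv_chart[OF \<kappa>])
    have "coord_shape \<kappa> x (coord_T \<kappa> x) = \<mu> *\<^sub>R coord_T \<kappa> x"
      by (rule L.T_eigenvector) (fact finite in_\<Lambda> dim2 x)+
    then have "A p (T p) = \<mu> *\<^sub>R T p"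
      unfolding Tx unfolding x_def by (rule coord_shape_eigenvector_iff[OF \<kappa>, THEN iffD1])
    moreover have "coord_T \<kappa> x \<noteq> 0"
      by (rule L.T_nonzero) (fact finite in_\<Lambda> dim2 x l w)+
    then have "T p \<noteq> 0"
      using coord_change_eq_0_iff[OF \<kappa>] by (simp add: Tx)
    moreover have "k \<noteq> 0" if "k \<in> \<Lambda>" "k \<noteq> \<mu>" for k
      by (rule L.multiple_eigenvalue_nonzero) (fact finite in_\<Lambda> dim2 x that w)+
    ultimately show ?thesis by blast
  qed
  \<comment> \<open>The claim about multiple curvatures mentions no point, so one is taken from the
    nonempty manifold.\<close>
  obtain p where "p \<in> topspace X" using assms(5) by blast
  then have "\<forall>l\<in>\<Lambda>. m l > 1 \<longrightarrow> l \<noteq> 0"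
    using pointwise \<mu>(2) by (metis less_irrefl)
  moreover have "\<forall>l\<in>\<Lambda>. m l = 1 \<longrightarrow> principal_direction X A T l"
    using pointwise uniq by (auto simp: principal_direction_def)
  ultimately show ?thesis by blast
qed

end
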